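(* (Session Fidelity.) Let $N\parallel\mathcal M$ be a network with queue and $G\parallel\mathcal M$ a well-formed asynchronous type such that $\vdash N\parallel\mathcal M : G\parallel\mathcal M$. If $G\parallel\mathcal M\xrightarrow{\beta}G'\parallel\mathcal M'$, then there is a network $N'$ such that $N\parallel\mathcal M\xrightarrow{\beta}N'\parallel\mathcal M'$ and $\vdash N'\parallel\mathcal M' : G'\parallel\mathcal M'$.
   Context: Participants $p,q,r,s$ range over a set; labels $\ell$ over a set. An action is $p!\ell$ (output to $p$) or $p?\ell$ (input from $p$). Processes are the regular (finitely many distinct subterms), possibly infinite terms coinductively generated by $P::=\bigoplus_{i\in I}q!\ell_i;P_i\mid\sum_{i\in I}q?\ell_i;P_i\mid\mathbf 0$, with $I$ finite non-empty and the $\ell_i$ pairwise distinct. A message is a triple $(p,\ell,q)$ (sender $p$, receiver $q$); a queue $\mathcal M$ is a finite sequence of messages ($\emptyset$ empty, $\cdot$ concatenation), taken modulo the least equivalence $\equiv$ that allows two adjacent messages $(p,\ell,q),(r,\ell',s)$ to be swapped whenever $p\neq r$ or $q\neq s$. A network $N=p_1[P_1]\parallel\cdots\parallel p_n[P_n]$ has pairwise distinct participants; parallel composition is associative and commutative with neutral element $p[\mathbf 0]$. A communication $\beta$ is $pq!\ell$ or $pq?\ell$; $\mathrm{play}(pq!\ell)=\{p\}$, $\mathrm{play}(pq?\ell)=\{q\}$. The LTS of networks with queues has exactly the rules $p[\bigoplus_{i\in I}q!\ell_i;P_i]\parallel N\parallel\mathcal M\xrightarrow{pq!\ell_k}p[P_k]\parallel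 N\parallel\mathcal M\cdot(p,\ell_k,q)$ for $k\in I$, and $q[\sum_{j\in J}p?\ell_j;Q_j]\parallel N\parallel(p,\ell_k,q)\cdot\mathcal M\xrightarrow{pq?\ell_k}q[Q_k]\parallel N\parallel\mathcal M$ for $k\in J$. Global types are regular terms coinductively generated by $G::=\boxplus_{i\in I}pq!\ell_i;G_i\mid pq?\ell;G\mid\mathsf{End}$ ($I$ finite non-empty, labels pairwise distinct); an asynchronous type is a pair $G\parallel\mathcal M$. $\mathrm{play}(G)$ is the least set with $\mathrm{play}(\boxplus_i pq!\ell_i;G_i)=\{p\}\cup\bigcup_i\mathrm{play}(G_i)$, $\mathrm{play}(pq?\ell;G)=\{q\}\cup\mathrm{play}(G)$, $\mathrm{play}(\mathsf{End})=\emptyset$; extended to sequences of communications by union. $\mathrm{Tr}(G)$ is the set of sequences of communications read along paths from the root to an edge of the tree of $G$ (nodes labelled $pq!$ / $pq?$, edges by labels). $G$ is cyclic if its tree contains itself as a proper subtree. Projection $G\upharpoonright r$ (partial, coinductive; $\vec\pi$ a possibly empty sequence of actions): $G\upharpoonright r=\mathbf 0$ if $r\notin\mathrm{play}(G)$; $(\boxplus_{i\in I}pq!\ell_i;G_i)\upharpoonright r$ is $\bigoplus_{i\in I}q!\ell_i;(G_i\upharpoonright p)$ if $r=p$; $G_1\upharpoonright q$ if $r=q$ and $I=\{1\}$; $\vec\pi;\sum_{i\in I}p?\ell_i;P_i$ if $r=q$, $|I|>1$ and $G_i\upharpoonright q=\vec\pi;p?\ell_i;P_i$ for all $i$; $G_1\upharpoonright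 r$ if $r\notin\{p,q\}$, $r\in\mathrm{play}(G_1)$ and $G_i\upharpoonright r=G_1\upharpoonright r$ for all $i$; $(pq?\ell;G)\upharpoonright r$ is $p?\ell;(G\upharpoonright r)$ if $r=q$, and $G\upharpoonright r$ if $r\ne q$ and $r\in\mathrm{play}(G)$; undefined otherwise. Depth: $\mathrm{ord}(\tau,p)=n$ if $\tau=\tau_1\cdot\beta\cdot\tau_2$ with $|\tau_1|=n-1$, $p\notin\mathrm{play}(\tau_1)$, $p\in\mathrm{play}(\beta)$, else $0$; $\mathrm{depth}(G,p)=\sup\{\mathrm{ord}(\tau,p)\mid\tau\in\mathrm{Tr}(G)\}$ if $p\in\mathrm{play}(G)$, else $0$. $G$ is bounded if $\mathrm{depth}(G',p)<\infty$ for all subtrees $G'$ of $G$ and all $p$. Balancing: $\vdash G\parallel\mathcal M$ if derivable by a possibly infinite derivation from: $\vdash\mathsf{End}\parallel\emptyset$; from $\vdash G\parallel\mathcal M$ infer $\vdash pq?\ell;G\parallel(p,\ell,q)\cdot\mathcal M$; from $\vdash G_i\parallel\mathcal M\cdot(p,\ell_i,q)$ for all $i\in I$ infer $\vdash\boxplus_{i\in I}pq!\ell_i;G_i\parallel\mathcal M$, provided $\mathcal M=\emptyset$ if $\boxplus_{i\in I}pq!\ell_i;G_i$ is cyclic. $G\parallel\mathcal M$ is well formed if balanced, $G\upharpoonright p$ is defined for all $p$, and $G$ is bounded. Preorder: $\le$ is the largest relation on processes such that $P\le Q$ implies either $P=Q=\mathbf 0$; or $P=\bigoplus_{i\in I}p!\ell_i;P_i$,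 $Q=\bigoplus_{i\in I}p!\ell_i;Q_i$, $P_i\le Q_i$ for all $i$; or $P=\sum_{i\in I\cup J}p?\ell_i;P_i$, $Q=\sum_{i\in I}p?\ell_i;Q_i$, $P_i\le Q_i$ for all $i\in I$. Typing: for well-formed $G\parallel\mathcal M$, $\vdash N\parallel\mathcal M:G\parallel\mathcal M$ iff $N=\prod_{i\in I}p_i[P_i]$ with $P_i\le G\upharpoonright p_i$ for all $i$ and $\mathrm{play}(G)\subseteq\{p_i\mid i\in I\}$. LTS of asynchronous types (inductive rules): (Ext-Out) $\boxplus_{i\in I}pq!\ell_i;G_i\parallel\mathcal M\xrightarrow{pq!\ell_k}G_k\parallel\mathcal M\cdot(p,\ell_k,q)$, $k\in I$; (Ext-In) $pq?\ell;G\parallel(p,\ell,q)\cdot\mathcal M\xrightarrow{pq?\ell}G\parallel\mathcal M$; (IComm-Out) if $G_i\parallel\mathcal M\cdot(p,\ell_i,q)\xrightarrow{\beta}G'_i\parallel\mathcal M'\cdot(p,\ell_i,q)$ for all $i\in I$ and $p\notin\mathrm{play}(\beta)$ then $\boxplus_{i\in I}pq!\ell_i;G_i\parallel\mathcal M\xrightarrow{\beta}\boxplus_{i\in I}pq!\ell_i;G'_i\parallel\mathcal M'$; (IComm-In) if $G\parallel\mathcal M\xrightarrow{\beta}G'\parallel\mathcal M'$ and $q\notin\mathrm{play}(\beta)$ then $pq?\ell;G\parallel(p,\ell,q)\cdot\mathcal M\xrightarrow{\beta}pq?\ell;G'\parallel(p,\ell,q)\cdot\mathcal M'$. *)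

theory Defs
  imports "HOL-Library.Finite_Map" "HOL-Library.Extended_Nat"
begin

text \<open>Throughout, \<open>'p\<close> is the set of participants and \<open>'l\<close> the set of labels.  An indexed family of
  branches with pairwise distinct labels is a finite map from labels to continuations, so the
  index set \<open>I\<close> is the domain of the map.  The codatatypes contain all finitely branching trees;
  regularity and non-emptiness of the branchings are imposed by the predicates \<open>process\<close> and
  \<open>global_type\<close>.\<close>

codatatype ('p, 'l) proc =
    Send 'p "('l, ('p, 'l) proc) fmap"
  | Recv 'p "('l, ('p, 'l) proc) fmap"
  | Inact

inductive proc_child :: "('p, 'l) proc \<Rightarrow> ('p, 'l) proc \<Rightarrow> bool" where
  "fmlookup B l = Some P \<Longrightarrow> proc_child (Send q B) P"
| "fmlookup B l = Some P \<Longrightarrow> proc_child (Recv q B) P"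

definition proc_subterms :: "('p, 'l) proc \<Rightarrow> ('p, 'l) proc set" where
  "proc_subterms P = {Q. proc_child\<^sup>*\<^sup>* P Q}"

definition process :: "('p, 'l) proc \<Rightarrow> bool" where
  "process P \<longleftrightarrow> finite (proc_subterms P) \<and>
     (\<forall>q B. Send q B \<in> proc_subterms P \<or> Recv q B \<in> proc_subterms P \<longrightarrow> B \<noteq> fmempty)"

datatype ('p, 'l) action = SendA 'p 'l | RecvA 'p 'l

primrec prefix_action :: "('p, 'l) action \<Rightarrow> ('p, 'l) proc \<Rightarrow> ('p, 'l) proc" where
  "prefix_action (SendA q l) P = Send q (fmupd l P fmempty)"
| "prefix_action (RecvA q l) P = Recv q (fmupd l P fmempty)"

definition prefix_actions :: "('p, 'l) action list \<Rightarrow> ('p, 'l) proc \<Rightarrow> ('p, 'l) proc" where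
  "prefix_actions \<pi> P = foldr prefix_action \<pi> P"

text \<open>In the input rule below, \<open>dom B\<close> is \<open>I \<union> J\<close> and \<open>dom C\<close> is \<open>I\<close>.\<close>

coinductive proc_le :: "('p, 'l) proc \<Rightarrow> ('p, 'l) proc \<Rightarrow> bool" (infix \<open>\<preceq>\<close> 50) where
  le_Nil: "Inact \<preceq> Inact"
| le_Send: "\<lbrakk>fmdom' B = fmdom' C;
     \<And>l P Q. \<lbrakk>fmlookup B l = Some P; fmlookup C l = Some Q\<rbrakk> \<Longrightarrow> P \<preceq> Q\<rbrakk>
   \<Longrightarrow> Send p B \<preceq> Send p C"
| le_Recv: "\<lbrakk>fmdom' C \<subseteq> fmdom' B;
     \<And>l P Q. \<lbrakk>fmlookup B l = Some P; fmlookup C l = Some Q\<rbrakk> \<Longrightarrow> P \<preceq> Q\<rbrakk>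
   \<Longrightarrow> Recv p B \<preceq> Recv p C"

text \<open>A message is a triple (sender, label, receiver).\<close>

type_synonym ('p, 'l) msg = "'p \<times> 'l \<times> 'p"

inductive msg_swap :: "('p, 'l) msg list \<Rightarrow> ('p, 'l) msg list \<Rightarrow> bool" where
  "p \<noteq> r \<or> q \<noteq> s \<Longrightarrow> msg_swap (xs @ [(p, l, q), (r, l', s)] @ ys) (xs @ [(r, l', s), (p, l, q)] @ ys)"

quotient_type ('p, 'l) queue = "('p, 'l) msg list" / "equivclp msg_swap"
  by (rule equivp_evquivclp)

lemma msg_swap_append: "msg_swap xs ys \<Longrightarrow> msg_swap (us @ xs @ vs) (us @ ys @ vs)"
  by (elim msg_swap.cases) (metis append.assoc msg_swap.intros)

lemma equivclp_msg_swap_append: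
  assumes "equivclp msg_swap xs ys"
  shows "equivclp msg_swap (us @ xs @ vs) (us @ ys @ vs)"
  using assms
proof (induction rule: equivclp_induct)
  case base
  show ?case by simp
next
  case (step y z)
  then have "msg_swap (us @ y @ vs) (us @ z @ vs) \<or> msg_swap (us @ z @ vs) (us @ y @ vs)"
    using msg_swap_append by blast
  with step.IH show ?case
    by (blast intro: equivclp_into_equivclp)
qed

lift_definition qempty :: "('p, 'l) queue" is "[]" .

lift_definition qmsg :: "'p \<Rightarrow> 'l \<Rightarrow> 'p \<Rightarrow> ('p, 'l) queue" is "\<lambda>p l q. [(p, l, q)]" .

lift_definition qappend :: "('p, 'l) queue \<Rightarrow> ('p, 'l) queue \<Rightarrow> ('p, 'l) queue" (infixr \<open>\<cdot>\<close> 65) is "(@)"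
proof -
  fix xs xs' ys ys' :: "('p, 'l) msg list"
  assume "equivclp msg_swap xs xs'" "equivclp msg_swap ys ys'"
  then have "equivclp msg_swap (xs @ ys) (xs' @ ys)" "equivclp msg_swap (xs' @ ys) (xs' @ ys')"
    using equivclp_msg_swap_append[of xs xs' "[]" ys] equivclp_msg_swap_append[of ys ys' xs' "[]"]
    by simp_all
  then show "equivclp msg_swap (xs @ ys) (xs' @ ys')"
    by (rule equivclp_trans)
qed

text \<open>\<open>OutC p q l\<close> is \<open>pq!l\<close> and \<open>InC p q l\<close> is \<open>pq?l\<close>; in both cases \<open>p\<close> is the sender of the
  message and \<open>q\<close> its receiver.\<close>

datatype ('p, 'l) comm = OutC 'p 'p 'l | InC 'p 'p 'l

primrec play_comm :: "('p, 'l) comm \<Rightarrow> 'p set" where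
  "play_comm (OutC p q l) = {p}"
| "play_comm (InC p q l) = {q}"

definition play_comms :: "('p, 'l) comm list \<Rightarrow> 'p set" where
  "play_comms \<tau> = (\<Union>\<beta>\<in>set \<tau>. play_comm \<beta>)"

text \<open>Parallel composition is associative and commutative with neutral element \<open>p[Inact]\<close> and the
  participants of a network are pairwise distinct, so a network (up to these laws) is a map from
  participants to processes which is \<open>Inact\<close> almost everywhere.  \<open>parallel A P\<close> is the parallel
  composition of the \<open>p[P p]\<close> for \<open>p \<in> A\<close>.\<close>

type_synonym ('p, 'l) net = "'p \<Rightarrow> ('p, 'l) proc"

definition network :: "('p, 'l) net \<Rightarrow> bool" where
  "network N \<longleftrightarrow> finite {p. N p \<noteq> Inact} \<and> (\<forall>p. process (N p))"

definition parallel :: "'p set \<Rightarrow> ('p \<Rightarrow> ('p, 'l) proc) \<Rightarrow> ('p, 'l) net" where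
  "parallel A P = (\<lambda>p. if p \<in> A then P p else Inact)"

inductive net_step ::
  "('p, 'l) net \<times> ('p, 'l) queue \<Rightarrow> ('p, 'l) comm \<Rightarrow> ('p, 'l) net \<times> ('p, 'l) queue \<Rightarrow> bool" where
  net_Out: "\<lbrakk>N p = Send q B; fmlookup B l = Some P\<rbrakk>
   \<Longrightarrow> net_step (N, M) (OutC p q l) (N(p := P), M \<cdot> qmsg p l q)"
| net_In: "\<lbrakk>N q = Recv p B; fmlookup B l = Some Q\<rbrakk>
   \<Longrightarrow> net_step (N, qmsg p l q \<cdot> M) (InC p q l) (N(q := Q), M)"

codatatype ('p, 'l) gtype =
    GOut 'p 'p "('l, ('p, 'l) gtype) fmap"
  | GIn 'p 'p 'l "('p, 'l) gtype"
  | End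

inductive gchild :: "('p, 'l) gtype \<Rightarrow> ('p, 'l) gtype \<Rightarrow> bool" where
  "fmlookup B l = Some G \<Longrightarrow> gchild (GOut p q B) G"
| "gchild (GIn p q l G) G"

definition subtrees :: "('p, 'l) gtype \<Rightarrow> ('p, 'l) gtype set" where
  "subtrees G = {G'. gchild\<^sup>*\<^sup>* G G'}"

definition global_type :: "('p, 'l) gtype \<Rightarrow> bool" where
  "global_type G \<longleftrightarrow> finite (subtrees G) \<and> (\<forall>p q B. GOut p q B \<in> subtrees G \<longrightarrow> B \<noteq> fmempty)"

definition cyclic :: "('p, 'l) gtype \<Rightarrow> bool" where
  "cyclic G \<longleftrightarrow> gchild\<^sup>+\<^sup>+ G G"

inductive in_play :: "('p, 'l) gtype \<Rightarrow> 'p \<Rightarrow> bool" where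
  "in_play (GOut p q B) p"
| "\<lbrakk>fmlookup B l = Some G; in_play G r\<rbrakk> \<Longrightarrow> in_play (GOut p q B) r"
| "in_play (GIn p q l G) q"
| "in_play G r \<Longrightarrow> in_play (GIn p q l G) r"

definition play :: "('p, 'l) gtype \<Rightarrow> 'p set" where
  "play G = {r. in_play G r}"

inductive is_trace :: "('p, 'l) gtype \<Rightarrow> ('p, 'l) comm list \<Rightarrow> bool" where
  "fmlookup B l = Some G \<Longrightarrow> is_trace (GOut p q B) [OutC p q l]"
| "\<lbrakk>fmlookup B l = Some G; is_trace G \<tau>\<rbrakk> \<Longrightarrow> is_trace (GOut p q B) (OutC p q l # \<tau>)"
| "is_trace (GIn p q l G) [InC p q l]"
| "is_trace G \<tau> \<Longrightarrow> is_trace (GIn p q l G) (InC p q l # \<tau>)"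

definition Tr :: "('p, 'l) gtype \<Rightarrow> ('p, 'l) comm list set" where
  "Tr G = {\<tau>. is_trace G \<tau>}"

text \<open>\<open>first_at \<tau> p n\<close> says that the first communication of \<open>\<tau>\<close> played by \<open>p\<close> is the \<open>n\<close>-th one,
  counting from 1; such an \<open>n\<close> is unique.\<close>

definition first_at :: "('p, 'l) comm list \<Rightarrow> 'p \<Rightarrow> nat \<Rightarrow> bool" where
  "first_at \<tau> p n \<longleftrightarrow> (\<exists>\<tau>\<^sub>1 \<beta> \<tau>\<^sub>2. \<tau> = \<tau>\<^sub>1 @ [\<beta>] @ \<tau>\<^sub>2 \<and> n = length \<tau>\<^sub>1 + 1 \<and>
     p \<notin> play_comms \<tau>\<^sub>1 \<and> p \<in> play_comm \<beta>)"

definition trace_ord :: "('p, 'l) comm list \<Rightarrow> 'p \<Rightarrow> nat" where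
  "trace_ord \<tau> p = (if \<exists>n. first_at \<tau> p n then THE n. first_at \<tau> p n else 0)"

definition gdepth :: "('p, 'l) gtype \<Rightarrow> 'p \<Rightarrow> enat" where
  "gdepth G p = (if p \<in> play G then SUP \<tau>\<in>Tr G. enat (trace_ord \<tau> p) else 0)"

definition gbounded :: "('p, 'l) gtype \<Rightarrow> bool" where
  "gbounded G \<longleftrightarrow> (\<forall>G'\<in>subtrees G. \<forall>p. gdepth G' p < \<infinity>)"

text \<open>\<open>proj G r P\<close> is the graph of the coinductive projection, with the clauses tried in the order
  in which they are listed; hence the sender clause takes precedence over the receiver clauses when
  \<open>p = q\<close>.  The guard \<open>r \<in> play G\<close> of the clauses after the first is left implicit except where it
  matters.  In \<open>proj_other_Out\<close>, \<open>k\<close> is the distinguished index 1.  On bounded global types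
  the projection is unique.\<close>

coinductive proj :: "('p, 'l) gtype \<Rightarrow> 'p \<Rightarrow> ('p, 'l) proc \<Rightarrow> bool" where
  proj_Inact: "r \<notin> play G \<Longrightarrow> proj G r Inact"
| proj_sender: "\<lbrakk>fmdom' C = fmdom' B;
     \<And>l G P. \<lbrakk>fmlookup B l = Some G; fmlookup C l = Some P\<rbrakk> \<Longrightarrow> proj G p P\<rbrakk>
   \<Longrightarrow> proj (GOut p q B) p (Send q C)"
| proj_receiver_single: "\<lbrakk>q \<noteq> p; B = fmupd l G fmempty; proj G q P\<rbrakk>
   \<Longrightarrow> proj (GOut p q B) q P"
| proj_receiver_choice: "\<lbrakk>q \<noteq> p; card (fmdom' B) > 1; fmdom' C = fmdom' B;
     \<And>l G P. \<lbrakk>fmlookup B l = Some G; fmlookup C l = Some P\<rbrakk>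
       \<Longrightarrow> proj G q (prefix_actions \<pi> (Recv p (fmupd l P fmempty)))\<rbrakk>
   \<Longrightarrow> proj (GOut p q B) q (prefix_actions \<pi> (Recv p C))"
| proj_other_Out: "\<lbrakk>r \<noteq> p; r \<noteq> q; fmlookup B k = Some G\<^sub>1; r \<in> play G\<^sub>1;
     \<And>l G. fmlookup B l = Some G \<Longrightarrow> proj G r P\<rbrakk>
   \<Longrightarrow> proj (GOut p q B) r P"
| proj_In: "proj G q P \<Longrightarrow> proj (GIn p q l G) q (Recv p (fmupd l P fmempty))"
| proj_other_In: "\<lbrakk>r \<noteq> q; r \<in> play G; proj G r P\<rbrakk> \<Longrightarrow> proj (GIn p q l G) r P"

definition projection :: "('p, 'l) gtype \<Rightarrow> 'p \<Rightarrow> ('p, 'l) proc \<Rightarrow> bool" where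
  "projection G r P \<longleftrightarrow> process P \<and> proj G r P"

coinductive balanced :: "('p, 'l) gtype \<Rightarrow> ('p, 'l) queue \<Rightarrow> bool" where
  bal_End: "balanced End qempty"
| bal_In: "balanced G M \<Longrightarrow> balanced (GIn p q l G) (qmsg p l q \<cdot> M)"
| bal_Out: "\<lbrakk>\<And>l G. fmlookup B l = Some G \<Longrightarrow> balanced G (M \<cdot> qmsg p l q);
     cyclic (GOut p q B) \<Longrightarrow> M = qempty\<rbrakk>
   \<Longrightarrow> balanced (GOut p q B) M"

definition well_formed :: "('p, 'l) gtype \<Rightarrow> ('p, 'l) queue \<Rightarrow> bool" where
  "well_formed G M \<longleftrightarrow> global_type G \<and> balanced G M \<and> (\<forall>p. \<exists>P. projection G p P) \<and> gbounded G"

inductive type_step ::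
  "('p, 'l) gtype \<times> ('p, 'l) queue \<Rightarrow> ('p, 'l) comm \<Rightarrow> ('p, 'l) gtype \<times> ('p, 'l) queue \<Rightarrow> bool" where
  Ext_Out: "fmlookup B l = Some G
   \<Longrightarrow> type_step (GOut p q B, M) (OutC p q l) (G, M \<cdot> qmsg p l q)"
| Ext_In: "type_step (GIn p q l G, qmsg p l q \<cdot> M) (InC p q l) (G, M)"
| IComm_Out: "\<lbrakk>fmdom' B' = fmdom' B;
     \<And>l G G'. \<lbrakk>fmlookup B l = Some G; fmlookup B' l = Some G'\<rbrakk>
       \<Longrightarrow> type_step (G, M \<cdot> qmsg p l q) \<beta> (G', M' \<cdot> qmsg p l q);
     p \<notin> play_comm \<beta>\<rbrakk>
   \<Longrightarrow> type_step (GOut p q B, M) \<beta> (GOut p q B', M')"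
| IComm_In: "\<lbrakk>type_step (G, M) \<beta> (G', M'); q \<notin> play_comm \<beta>\<rbrakk>
   \<Longrightarrow> type_step (GIn p q l G, qmsg p l q \<cdot> M) \<beta> (GIn p q l G', qmsg p l q \<cdot> M')"

definition typing :: "('p, 'l) net \<Rightarrow> ('p, 'l) gtype \<Rightarrow> ('p, 'l) queue \<Rightarrow> bool" where
  "typing N G M \<longleftrightarrow> well_formed G M \<and>
     (\<exists>A P. finite A \<and> N = parallel A P \<and> play G \<subseteq> A \<and>
       (\<forall>p\<in>A. \<exists>Q. projection G p Q \<and> P p \<preceq> Q))"

end

theory Submission
  imports Defs
begin

text \<open>A step of the type performed by \<open>r\<close> is matched by the first action of the projection onto
  \<open>r\<close>, hence by the process of \<open>r\<close>, so the point is that well-formedness and the typing of the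
  other participants survive the step.  Only the projection onto the receiver of an output can
  change: a branching on the chosen label, which comes after the inputs of the messages already
  queued on that channel, loses its other branches, and losing input branches makes a process larger
  in \<open>\<preceq>\<close>.  Balancing enters twice.  By regularity every path of a balanced type reaches \<open>End\<close> or
  a cycle, where the queue must be empty, so every queued message is eventually read; and the queue
  fixes the labels of the inputs preceding the branching, which locates it in the projection.\<close>

section \<open>Queues\<close>

text \<open>The projection clauses for uninvolved participants and for common prefixes demand that
  the branches of an output agree, while \<open>IComm_Out\<close> performs the step in each branch
  separately. The new projection of an idle participant is therefore not read off the new type: it
  is computed from the old projection and the queue by one function, \<open>residual\<close>, which
  is the same in every branch, and each clause has to be shown compatible with it. For the player
  itself the agreement comes from \<open>proc_step\<close> being deterministic.

  A second obstacle is that many nodes of a type leave no trace in the projection onto a given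
  participant, so looking at the next action of the process may mean descending several nodes. Facts
  about the beginning of a projected process thus need two nested inductions, one on the number of
  actions inspected and one on the finite depth supplied by boundedness.\<close>

lift_definition chan :: "'p \<Rightarrow> 'p \<Rightarrow> ('p, 'l) queue \<Rightarrow> 'l list" is
  "\<lambda>p q xs. map (\<lambda>(_, l, _). l) (filter (\<lambda>(r, _, s). r = p \<and> s = q) xs)"
proof -
  fix p q :: 'p and xs ys :: "('p, 'l) msg list"
  assume "equivclp msg_swap xs ys"
  then show "map (\<lambda>(_, l, _). l) (filter (\<lambda>(r, _, s). r = p \<and> s = q) xs)
      = map (\<lambda>(_, l, _). l) (filter (\<lambda>(r, _, s). r = p \<and> s = q) ys)"
    by (induction rule: equivclp_induct) (auto elim!: msg_swap.cases)
qed

lift_definition qsize :: "('p, 'l) queue \<Rightarrow> nat" is length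
proof -
  fix xs ys :: "('p, 'l) msg list"
  assume "equivclp msg_swap xs ys"
  then show "length xs = length ys"
    by (induction rule: equivclp_induct) (auto elim!: msg_swap.cases)
qed

lemma chan_qempty [simp]: "chan p q qempty = []"
  by transfer simp

lemma chan_qmsg: "chan p q (qmsg r l s) = (if r = p \<and> s = q then [l] else [])"
  by transfer simp

lemma chan_qappend [simp]: "chan p q (M \<cdot> K) = chan p q M @ chan p q K"
  by transfer simp

lemma qsize_qempty [simp]: "qsize qempty = 0"
  by transfer simp

lemma qsize_qmsg [simp]: "qsize (qmsg p l q) = 1"
  by transfer simp

lemma qsize_qappend [simp]: "qsize (M \<cdot> K) = qsize M + qsize K"
  by transfer simp

lemma qsize_eq_0_iff [simp]: "qsize M = 0 \<longleftrightarrow> M = qempty"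
proof
  assume "qsize M = 0"
  then show "M = qempty" by transfer simp
qed simp

lemma equivclp_msg_swap_move_to_front:
  assumes "\<And>m l'. m \<in> set us \<Longrightarrow> m \<noteq> (p, l', q)"
  shows "equivclp msg_swap (us @ (p, l, q) # vs) ((p, l, q) # us @ vs)"
  using assms
proof (induction us)
  case Nil
  show ?case by simp
next
  case (Cons m us)
  obtain r k s where m: "m = (r, k, s)" by (cases m)
  have "equivclp msg_swap (us @ (p, l, q) # vs) ((p, l, q) # us @ vs)"
    using Cons by simp
  then have 1: "equivclp msg_swap (m # us @ (p, l, q) # vs) (m # (p, l, q) # us @ vs)"
    using equivclp_msg_swap_append[of "us @ (p, l, q) # vs" "(p, l, q) # us @ vs" "[m]" "[]"] by simp
  have "r \<noteq> p \<or> s \<noteq> q" using Cons.prems[of m] m by auto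
  then have "msg_swap (m # (p, l, q) # us @ vs) ((p, l, q) # m # us @ vs)"
    using msg_swap.intros[of r p s q "[]" k l "us @ vs"] m by simp
  with 1 show ?case
    by (simp only: append_Cons) (rule equivclp_trans[OF _ r_into_equivclp])
qed

text \<open>The head of \<open>xs\<close> is also the first message on its channel in
  \<open>ys\<close>. Everything before it in \<open>ys\<close> lies on other channels, so swaps
  bring it to the front, and the induction continues with the rest. Thus the words on the channels
  are a complete invariant, and equations between queues become equations between lists.\<close>

lemma equivclp_msg_swap_eqI:
  fixes xs ys :: "('p, 'l) msg list"
  assumes "\<And>p q. map (\<lambda>(_, l, _). l) (filter (\<lambda>(r, _, s). r = p \<and> s = q) xs)
    = map (\<lambda>(_, l, _). l) (filter (\<lambda>(r, _, s). r = p \<and> s = q) ys)"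
  shows "equivclp msg_swap xs ys"
  using assms
proof (induction xs arbitrary: ys)
  case Nil
  have "ys = []"
  proof (rule ccontr)
    assume "ys \<noteq> []"
    then obtain p l q zs where "ys = (p, l, q) # zs" by (metis list.exhaust prod_cases3)
    then show False using Nil[of p q] by simp
  qed
  then show ?case by simp
next
  case (Cons x xs)
  obtain p l q where x: "x = (p, l, q)" by (cases x)
  have "\<exists>m\<in>set ys. (\<lambda>(r, _, s). r = p \<and> s = q) m"
    proof -
    have "filter (\<lambda>(r, _, s). r = p \<and> s = q) ys \<noteq> []"
      using Cons.prems[of p q] x by auto
    then show ?thesis by (auto simp: filter_empty_conv)
  qed
  then obtain us m vs where ys: "ys = us @ m # vs" and m: "(\<lambda>(r, _, s). r = p \<and> s = q) m"
    and us: "\<forall>m\<in>set us. \<not> (\<lambda>(r, _, s). r = p \<and> s = q) m"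
    by (rule split_list_first_propE)
  have "filter (\<lambda>(r, _, s). r = p \<and> s = q) us = []"
    using us by (simp add: filter_empty_conv)
  then have mx: "m = (p, l, q)"
    using Cons.prems[of p q] x m unfolding ys by (auto split: prod.splits)
  have move: "equivclp msg_swap ys (x # us @ vs)"
    unfolding ys mx x using us by (intro equivclp_msg_swap_move_to_front) auto
  have "map (\<lambda>(_, l, _). l) (filter (\<lambda>(r, _, s). r = p' \<and> s = q') xs)
    = map (\<lambda>(_, l, _). l) (filter (\<lambda>(r, _, s). r = p' \<and> s = q') (us @ vs))" for p' q'
  proof (cases "p' = p \<and> q' = q")
    case True
    then show ?thesis
      using Cons.prems[of p q] \<open>filter _ us = []\<close> unfolding ys x mx by simp
  next
    case False
    then show ?thesis
      using Cons.prems[of p' q'] unfolding ys x mx by auto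
  qed
  then have "equivclp msg_swap xs (us @ vs)" by (rule Cons.IH)
  then have "equivclp msg_swap (x # xs) (x # us @ vs)"
    using equivclp_msg_swap_append[of xs "us @ vs" "[x]" "[]"] by simp
  with move show ?case by (metis equivclp_sym equivclp_trans)
qed

lemma queue_eqI:
  assumes "\<And>p q. chan p q M = chan p q K"
  shows "M = K"
  using assms by transfer (rule equivclp_msg_swap_eqI)

lemma qappend_assoc: "(L \<cdot> M) \<cdot> K = L \<cdot> M \<cdot> K"
  by (rule queue_eqI) simp

lemma qappend_left_cancel [simp]: "L \<cdot> M = L \<cdot> K \<longleftrightarrow> M = K"
proof
  assume "L \<cdot> M = L \<cdot> K"
  then have "chan p q (L \<cdot> M) = chan p q (L \<cdot> K)" for p q by simp
  then show "M = K" by (intro queue_eqI) simp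
qed simp

lemma qappend_right_cancel [simp]: "M \<cdot> L = K \<cdot> L \<longleftrightarrow> M = K"
proof
  assume "M \<cdot> L = K \<cdot> L"
  then have "chan p q (M \<cdot> L) = chan p q (K \<cdot> L)" for p q by simp
  then show "M = K" by (intro queue_eqI) simp
qed simp

lemma qmsg_commute: "p \<noteq> r \<or> q \<noteq> s \<Longrightarrow> qmsg p l q \<cdot> qmsg r k s = qmsg r k s \<cdot> qmsg p l q"
  by (rule queue_eqI) (auto simp: chan_qmsg)

section \<open>Global types and balancing\<close>

lemma in_play_GOut: "in_play (GOut p q B) r \<longleftrightarrow> r = p \<or> (\<exists>l G. fmlookup B l = Some G \<and> in_play G r)"
  by (subst in_play.simps) auto

lemma in_play_GIn: "in_play (GIn p q l G) r \<longleftrightarrow> r = q \<or> in_play G r"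
  by (subst in_play.simps) auto

lemma in_play_End: "\<not> in_play End r"
  by (subst in_play.simps) auto

lemma play_GOut: "r \<in> play (GOut p q B) \<longleftrightarrow> r = p \<or> (\<exists>l G. fmlookup B l = Some G \<and> r \<in> play G)"
  by (simp add: play_def in_play_GOut)

lemma play_GIn [simp]: "play (GIn p q l G) = insert q (play G)"
  by (auto simp: play_def in_play_GIn)

lemma play_End [simp]: "play End = {}"
  by (auto simp: play_def in_play_End)

lemma gchild_GOut: "gchild (GOut p q B) H \<longleftrightarrow> (\<exists>l. fmlookup B l = Some H)"
  by (subst gchild.simps) auto

lemma gchild_GIn: "gchild (GIn p q l G) H \<longleftrightarrow> H = G"
  by (subst gchild.simps) auto

lemma gchild_End: "\<not> gchild End H"
  by (subst gchild.simps) auto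

lemma play_gchild: "gchild G H \<Longrightarrow> play H \<subseteq> play G"
  by (cases rule: gchild.cases) (auto simp: play_GOut)

lemma subtrees_refl: "G \<in> subtrees G"
  by (simp add: subtrees_def)

lemma subtrees_gchild: "gchild G H \<Longrightarrow> subtrees H \<subseteq> subtrees G"
  unfolding subtrees_def by (blast intro: converse_rtranclp_into_rtranclp)

lemma subtrees_unfold: "subtrees G = insert G (\<Union>H\<in>{H. gchild G H}. subtrees H)"
proof (rule set_eqI)
  fix K
  show "K \<in> subtrees G \<longleftrightarrow> K \<in> insert G (\<Union>H\<in>{H. gchild G H}. subtrees H)"
    unfolding subtrees_def
    by (simp, metis converse_rtranclpE converse_rtranclp_into_rtranclp rtranclp.rtrancl_refl)
qed

lemma finite_gchild: "finite {H. gchild G H}"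
proof (cases G)
  case (GOut p q B)
  then have "{H. gchild G H} = fmran' B"
    by (auto simp: gchild_GOut fmran'_def ran_def)
  then show ?thesis by (simp add: fmran'_alt_def)
qed (auto simp: gchild_GIn gchild_End)

lemma global_type_gchild: "global_type G \<Longrightarrow> gchild G H \<Longrightarrow> global_type H"
  using subtrees_gchild[of G H] finite_subset[of "subtrees H" "subtrees G"]
  by (auto simp: global_type_def)

lemma global_type_GOutD: "global_type (GOut p q B) \<Longrightarrow> fmlookup B l = Some G \<Longrightarrow> global_type G"
  by (rule global_type_gchild[OF _ gchild.intros(1)])

lemma global_type_GInD: "global_type (GIn p q l G) \<Longrightarrow> global_type G"
  by (rule global_type_gchild[OF _ gchild.intros(2)])

lemma global_type_GOut_nonempty:
  assumes "global_type (GOut p q B)"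
  obtains l G where "fmlookup B l = Some G"
proof -
  have "B \<noteq> fmempty" using assms subtrees_refl unfolding global_type_def by blast
  moreover have "B = fmempty" if "\<And>l. fmlookup B l = None"
    using that by (intro fmap_ext) simp
  ultimately obtain l where "fmlookup B l \<noteq> None" by blast
  then show ?thesis using that by blast
qed

text \<open>The proper subtrees of a node are subtrees of its finitely many children, so regularity
  passes from the children to the node. This suits steps, which rewrite only the nodes above the
  place where they act.\<close>

lemma global_typeI:
  assumes "\<And>H. gchild G H \<Longrightarrow> global_type H" and "\<And>p q. G \<noteq> GOut p q fmempty"
  shows "global_type G"
proof -
  have "finite (subtrees G)"
    using assms(1) finite_gchild[of G] by (subst subtrees_unfold) (auto simp: global_type_def)
  moreover have "B \<noteq> fmempty" if B: "GOut p q B \<in> subtrees G" for p q B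
  proof -
    from B consider "GOut p q B = G" | H where "gchild G H" "GOut p q B \<in> subtrees H"
      by (subst (asm) subtrees_unfold) auto
    then show ?thesis using assms unfolding global_type_def by cases metis+
  qed
  ultimately show ?thesis by (auto simp: global_type_def)
qed

lemma balanced_GOutD:
  assumes "balanced (GOut p q B) M"
  shows "fmlookup B l = Some G \<Longrightarrow> balanced G (M \<cdot> qmsg p l q)"
    and "cyclic (GOut p q B) \<Longrightarrow> M = qempty"
  using assms by (cases rule: balanced.cases; simp)+

lemma balanced_GInD:
  assumes "balanced (GIn p q l G) M"
  obtains K where "M = qmsg p l q \<cdot> K" "balanced G K"
  using assms by (cases rule: balanced.cases) (auto intro: that)

lemma balanced_GIn_qmsg [simp]: "balanced (GIn p q l G) (qmsg p l q \<cdot> M) \<longleftrightarrow> balanced G M"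
proof
  assume "balanced (GIn p q l G) (qmsg p l q \<cdot> M)"
  then show "balanced G M" by (rule balanced_GInD) simp
qed (rule bal_In)

lemma balanced_EndD: "balanced End M \<Longrightarrow> M = qempty"
  by (cases rule: balanced.cases) auto

section \<open>Queue size along paths of a type\<close>

inductive path_weight :: "('p, 'l) gtype \<Rightarrow> int \<Rightarrow> ('p, 'l) gtype \<Rightarrow> bool" where
  path_refl: "path_weight G 0 G"
| path_Out: "\<lbrakk>fmlookup B l = Some G; path_weight G d H\<rbrakk> \<Longrightarrow> path_weight (GOut p q B) (d + 1) H"
| path_In: "path_weight G d H \<Longrightarrow> path_weight (GIn p q l G) (d - 1) H"

lemma rtranclp_gchild_path_weight:
  assumes "gchild\<^sup>*\<^sup>* G H"
  shows "\<exists>d. path_weight G d H"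
  using assms
proof (induction rule: converse_rtranclp_induct)
  case base
  show ?case by (blast intro: path_refl)
next
  case (step G H)
  then show ?case by (auto elim!: gchild.cases intro: path_Out path_In)
qed

text \<open>Each output adds a message and each input removes one, so the weight, outputs minus
  inputs, is the change in size. It may be negative, hence the integers.\<close>

lemma balanced_path_weight:
  assumes "path_weight G d H" and "balanced G M"
  shows "\<exists>K. balanced H K \<and> int (qsize K) = int (qsize M) + d"
  using assms
proof (induction arbitrary: M)
  case (path_refl G)
  then show ?case by auto
next
  case (path_Out B l G d H p q)
  then have "balanced G (M \<cdot> qmsg p l q)" by (blast dest: balanced_GOutD(1))
  from path_Out.IH[OF this] show ?case by (auto simp: algebra_simps)
next
  case (path_In G d H p q l)
  obtain K where "M = qmsg p l q \<cdot> K" "balanced G K"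
    using path_In.prems by (rule balanced_GInD)
  with path_In.IH[of K] show ?case by auto
qed

text \<open>The cycle through \<open>GOut p q B\<close> changes the size of the queue by a fixed amount.  Followed
  once from \<open>M\<close> it ends in the empty queue, and so it does when followed again.\<close>

lemma balanced_GOutI:
  assumes children: "\<And>l G. fmlookup B l = Some G \<Longrightarrow> balanced G (M \<cdot> qmsg p l q)"
  shows "balanced (GOut p q B) M"
proof (rule bal_Out)
  assume cyc: "cyclic (GOut p q B)"
  then obtain l G where G: "fmlookup B l = Some G" and "gchild\<^sup>*\<^sup>* G (GOut p q B)"
    unfolding cyclic_def by (auto dest!: tranclpD simp: gchild_GOut)
  \<comment> \<open>This is the weight of the cycle without its first edge; the output at the root
    contributes the remaining 1.\<close>
  then obtain d where d: "path_weight G d (GOut p q B)"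
    using rtranclp_gchild_path_weight by blast
  obtain K where K: "balanced (GOut p q B) K" "int (qsize K) = int (qsize (M \<cdot> qmsg p l q)) + d"
    using balanced_path_weight[OF d children[OF G]] by blast
  with cyc have "K = qempty" by (blast dest: balanced_GOutD(2))
  with K G have "balanced G (qempty \<cdot> qmsg p l q)" by (blast dest: balanced_GOutD(1))
  from balanced_path_weight[OF d this] obtain K'
    where K': "balanced (GOut p q B) K'" "int (qsize K') = int (qsize (qempty \<cdot> qmsg p l q)) + d"
    by blast
  with cyc have "K' = qempty" by (blast dest: balanced_GOutD(2))
  with K K' \<open>K = qempty\<close> have "1 + int (qsize M) + d = 0" "1 + d = 0" by simp_all
  then have "qsize M = 0" by linarith
  then show "M = qempty" by simp
qed (rule children)

section \<open>Invariants of a step of the type\<close>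

lemma type_step_output_queue:
  assumes "type_step (G, M) (OutC p q l) (G', M')" and "global_type G"
  shows "M' = M \<cdot> qmsg p l q"
  using assms
proof (induction "(G, M)" "OutC p q l" "(G', M')" arbitrary: G M G' M')
  case (IComm_Out B' B M r s M')
  \<comment> \<open>The premises of \<open>IComm_Out\<close> constrain \<open>M'\<close> only
    through the branches, so one branch must exist; non-emptiness of the branchings supplies
    it.\<close>
  obtain k H where H: "fmlookup B k = Some H"
    using IComm_Out.prems by (rule global_type_GOut_nonempty)
  then obtain H' where H': "fmlookup B' k = Some H'"
    using IComm_Out.hyps(1) by (metis fmlookup_dom'_iff)
  have "global_type H"
    using IComm_Out.prems H by (rule global_type_GOutD)
  then have "M' \<cdot> qmsg r k s = (M \<cdot> qmsg r k s) \<cdot> qmsg p l q"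
    using IComm_Out.hyps(3)[OF H H'] by blast
  \<comment> \<open>The sender \<open>r\<close> of the node does not play in the communication, so
    it differs from \<open>p\<close> and the two messages may be swapped.\<close>
  also have "\<dots> = (M \<cdot> qmsg p l q) \<cdot> qmsg r k s"
    using IComm_Out.hyps(4) qmsg_commute[of r p s q k l] by (simp add: qappend_assoc)
  finally show ?case by simp
next
  case (IComm_In G M G' M' s r k)
  then have "M' = M \<cdot> qmsg p l q"
    by (blast dest: global_type_GInD)
  then show ?case by (simp add: qappend_assoc)
qed auto

lemma type_step_input_queue:
  assumes "type_step (G, M) (InC p q l) (G', M')" and "global_type G"
  shows "M = qmsg p l q \<cdot> M'"
  using assms
proof (induction "(G, M)" "InC p q l :: ('a, 'b) comm" "(G', M')" arbitrary: G M G' M')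
  case (IComm_Out B' B M r s M')
  obtain k H where H: "fmlookup B k = Some H"
    using IComm_Out.prems by (rule global_type_GOut_nonempty)
  then obtain H' where H': "fmlookup B' k = Some H'"
    using IComm_Out.hyps(1) by (metis fmlookup_dom'_iff)
  have "global_type H"
    using IComm_Out.prems H by (rule global_type_GOutD)
  then have "M \<cdot> qmsg r k s = (qmsg p l q \<cdot> M') \<cdot> qmsg r k s"
    using IComm_Out.hyps(3)[OF H H'] by (simp add: qappend_assoc)
  then show ?case by simp
next
  case (IComm_In G M G' M' s r k)
  then have M: "M = qmsg p l q \<cdot> M'"
    by (blast dest: global_type_GInD)
  \<comment> \<open>Here the receivers differ, as \<open>s\<close> does not play in the
    input.\<close>
  have "qmsg r k s \<cdot> qmsg p l q = qmsg p l q \<cdot> qmsg r k s"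
    using IComm_In.hyps(3) by (intro qmsg_commute) auto
  then have "(qmsg r k s \<cdot> qmsg p l q) \<cdot> M' = (qmsg p l q \<cdot> qmsg r k s) \<cdot> M'" by simp
  then show ?case unfolding M qappend_assoc .
qed auto

lemma type_step_balanced:
  assumes "type_step (G, M) \<beta> (G', M')" and "balanced G M"
  shows "balanced G' M'"
  using assms
proof (induction "(G, M)" \<beta> "(G', M')" arbitrary: G M G' M')
  case (Ext_Out B l G p q M)
  then show ?case by (blast dest: balanced_GOutD(1))
next
  case (IComm_Out B' B M p q \<beta> M')
  show ?case
  \<comment> \<open>Rewriting the branches could change which nodes lie on cycles; by this rule the
    condition on cycles follows from the balance of the branches.\<close>
  proof (rule balanced_GOutI)
    fix l G'
    assume G': "fmlookup B' l = Some G'"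
    then obtain G where "fmlookup B l = Some G"
      using IComm_Out.hyps(1) by (metis fmlookup_dom'_iff)
    with IComm_Out.hyps(3)[OF _ G'] IComm_Out.prems show "balanced G' (M' \<cdot> qmsg p l q)"
      by (blast dest: balanced_GOutD(1))
  qed
qed simp_all

lemma type_step_global_type:
  assumes "type_step (G, M) \<beta> (G', M')" and "global_type G"
  shows "global_type G'"
  using assms
proof (induction "(G, M)" \<beta> "(G', M')" arbitrary: G M G' M')
  case (Ext_Out B l G p q M)
  then show ?case by (blast dest: global_type_GOutD)
next
  case (Ext_In p q l G M)
  then show ?case by (blast dest: global_type_GInD)
next
  case (IComm_Out B' B M p q \<beta> M')
  show ?case
  proof (rule global_typeI)
    fix H'
    assume "gchild (GOut p q B') H'"
    then obtain l where H': "fmlookup B' l = Some H'" by (auto simp: gchild_GOut)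
    then obtain H where H: "fmlookup B l = Some H"
      using IComm_Out.hyps(1) by (metis fmlookup_dom'_iff)
    then show "global_type H'"
      using IComm_Out.hyps(3)[OF H H'] IComm_Out.prems by (blast dest: global_type_GOutD)
  next
    fix r s
    obtain k H where "fmlookup B k = Some H"
      using IComm_Out.prems by (rule global_type_GOut_nonempty)
    then have "k \<in> fmdom' B'" using IComm_Out.hyps(1) by (metis fmlookup_dom'_iff option.distinct(1))
    then show "GOut p q B' \<noteq> GOut r s fmempty" by auto
  qed
next
  case (IComm_In G M \<beta> G' M' q p l)
  then have "global_type G'" by (blast dest: global_type_GInD)
  then show ?case by (auto simp: gchild_GIn intro!: global_typeI[of "GIn p q l G'"])
qed

lemma type_step_play:
  assumes "type_step (G, M) \<beta> (G', M')"
  shows "play G' \<subseteq> play G"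
  using assms
proof (induction "(G, M)" \<beta> "(G', M')" arbitrary: G M G' M')
  case (IComm_Out B' B M p q \<beta> M')
  show ?case
  proof
    fix r
    assume "r \<in> play (GOut p q B')"
    then consider "r = p" | l H' where "fmlookup B' l = Some H'" "r \<in> play H'"
      by (auto simp: play_GOut)
    then show "r \<in> play (GOut p q B)"
    proof cases
      case 2
      then obtain H where H: "fmlookup B l = Some H"
        using IComm_Out.hyps(1) by (metis fmlookup_dom'_iff)
      with IComm_Out.hyps(3)[OF H] 2 show ?thesis by (auto simp: play_GOut)
    qed (simp add: play_GOut)
  qed
qed (auto simp: play_GOut)

lemma type_step_player:
  assumes "type_step (G, M) \<beta> (G', M')" and "global_type G"
  shows "play_comm \<beta> \<subseteq> play G"
  using assms
proof (induction "(G, M)" \<beta> "(G', M')" arbitrary: G M G' M')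
  case (IComm_Out B' B M p q \<beta> M')
  obtain k H where H: "fmlookup B k = Some H"
    using IComm_Out.prems by (rule global_type_GOut_nonempty)
  then obtain H' where H': "fmlookup B' k = Some H'"
    using IComm_Out.hyps(1) by (metis fmlookup_dom'_iff)
  have "global_type H"
    using IComm_Out.prems H by (rule global_type_GOutD)
  then have "play_comm \<beta> \<subseteq> play H"
    using IComm_Out.hyps(3)[OF H H'] by blast
  then show ?case using H unfolding subset_iff play_GOut by blast
next
  case (IComm_In G M \<beta> G' M' q p l)
  then have "global_type G" by (blast dest: global_type_GInD)
  with IComm_In show ?case by auto
qed (auto simp: play_GOut)

text \<open>The balancing condition on cycles guarantees that no message stays in the queue forever.\<close>

lemma cyclic_balanced_receiver_in_play:
  assumes "cyclic G" and "balanced G M" and "chan p q M \<noteq> []"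
  shows "q \<in> play G"
  using assms
proof (induction "qsize M" arbitrary: G M rule: less_induct)
  case less
  show ?case
  proof (cases G)
    case (GOut r s B)
    then have "M = qempty" using less.prems(1,2) by (simp add: balanced_GOutD(2))
    then show ?thesis using less.prems(3) by simp
  next
    case (GIn r s l H)
    have "gchild\<^sup>*\<^sup>* H G"
      using less.prems(1) GIn unfolding cyclic_def by (auto dest!: tranclpD simp: gchild_GIn)
    moreover have "gchild G H" using GIn by (simp add: gchild_GIn)
    ultimately have "cyclic H" unfolding cyclic_def by simp
    from less.prems(2)[unfolded GIn] obtain K where "M = qmsg r l s \<cdot> K" "balanced H K"
      by (rule balanced_GInD)
    \<comment> \<open>Either the input is played by \<open>q\<close>, or it leaves the channel
      unchanged and \<open>H\<close> is again cyclic, with one queued message less.\<close>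
    then show ?thesis
      using less.hyps[of K H] less.prems(3) \<open>cyclic H\<close> GIn
      by (auto simp: chan_qmsg split: if_splits)
  next
    case End
    then show ?thesis
      using less.prems(1) unfolding cyclic_def by (auto dest!: tranclpD simp: gchild_End)
  qed
qed

text \<open>Otherwise the child relation on the finitely many reachable subtrees would be acyclic,
  hence well-founded, although every one of them has a child.\<close>

lemma global_type_reaches_End_or_cyclic:
  assumes "global_type G"
  shows "\<exists>H. gchild\<^sup>*\<^sup>* G H \<and> (H = End \<or> cyclic H)"
proof (rule ccontr)
  assume contra: "\<not> ?thesis"
  define R where "R = {(H, K). gchild K H \<and> gchild\<^sup>*\<^sup>* G K}"
  have "finite (subtrees G)" using assms by (simp add: global_type_def)
  moreover have "R \<subseteq> subtrees G \<times> subtrees G"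
    unfolding R_def subtrees_def by (auto dest: rtranclp.rtrancl_into_rtrancl)
  ultimately have "finite R" by (meson finite_SigmaI finite_subset)
  have path: "gchild\<^sup>+\<^sup>+ K H \<and> gchild\<^sup>*\<^sup>* G K" if "(H, K) \<in> R\<^sup>+" for H K
    using that
  proof (induction rule: trancl_induct)
    case (step K' K)
    then show ?case by (metis (mono_tags) R_def case_prodD mem_Collect_eq tranclp_into_tranclp2)
  qed (auto simp: R_def)
  have "acyclic R"
    unfolding acyclic_def using path contra by (auto simp: cyclic_def)
  with \<open>finite R\<close> have "wf R" by (rule finite_acyclic_wf)
  have False if "gchild\<^sup>*\<^sup>* G H" for H
    using \<open>wf R\<close> that
  proof (induction H)
    case (less H)
    have "global_type H"
      using less.prems assms by (induction rule: rtranclp_induct) (simp, rule global_type_gchild)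
    have "\<exists>K. gchild H K"
    proof (cases H)
      case (GOut p q B)
      from \<open>global_type H\<close>[unfolded GOut] show ?thesis
        by (rule global_type_GOut_nonempty) (auto simp: GOut gchild_GOut)
    next
      case (GIn p q l K)
      then show ?thesis by (simp add: gchild_GIn)
    next
      case End
      then show ?thesis using contra less.prems by blast
    qed
    then obtain K where "gchild H K" by blast
    then show False
      using less.IH[of K] less.prems rtranclp.rtrancl_into_rtrancl[of gchild G H K] by (simp add: R_def)
  qed
  then show False by blast
qed

text \<open>Along a path on which \<open>q\<close> never plays, a message to \<open>q\<close> stays
  in the queue. The path can be chosen to end in \<open>End\<close>, where the queue is empty, or in
  a cyclic type, where \<open>q\<close> must play.\<close>

lemma balanced_receiver_in_play:
  assumes "global_type G" and "balanced G M" and "chan p q M \<noteq> []"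
  shows "q \<in> play G"
proof -
  have step: "play H \<subseteq> play G \<and> (q \<in> play G \<or> (\<exists>K. balanced H K \<and> chan p q K \<noteq> []))"
    if "gchild\<^sup>*\<^sup>* G H" for H
    using that
  proof (induction rule: rtranclp_induct)
    case base
    then show ?case using assms by blast
  next
    case (step H J)
    show ?case
    proof (cases "q \<in> play G")
      case True
      then show ?thesis using step.IH play_gchild[OF step.hyps(2)] by blast
    next
      case False
      then obtain K where K: "balanced H K" "chan p q K \<noteq> []" using step.IH by blast
      have "\<exists>L. balanced J L \<and> chan p q L \<noteq> []"
        using step.hyps(2)
      proof cases
        case (1 B l r s)
        then have "balanced J (K \<cdot> qmsg r l s)" using K by (blast dest: balanced_GOutD(1))
        then show ?thesis using K by (metis chan_qappend append_is_Nil_conv)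
      next
        case (2 r s l)
        from K(1)[unfolded 2] obtain L where L: "K = qmsg r l s \<cdot> L" "balanced J L"
          by (rule balanced_GInD)
        have "s \<noteq> q" using False step.IH 2 by auto
        then show ?thesis using L K by (auto simp: chan_qmsg)
      qed
      then show ?thesis using step.IH play_gchild[OF step.hyps(2)] by blast
    qed
  qed
  obtain H where H: "gchild\<^sup>*\<^sup>* G H" "H = End \<or> cyclic H"
    using global_type_reaches_End_or_cyclic[OF assms(1)] by blast
  show ?thesis
  proof (rule ccontr)
    assume "q \<notin> play G"
    then obtain K where K: "balanced H K" "chan p q K \<noteq> []" "q \<notin> play H"
      using step[OF H(1)] by blast
    then show False
      using H(2) cyclic_balanced_receiver_in_play[of H K p q] balanced_EndD[of K] by auto
  qed
qed

lemma balanced_GOut_receiver_in_play: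
  assumes "global_type (GOut p q B)" and "balanced (GOut p q B) M" and "fmlookup B l = Some G"
  shows "q \<in> play G"
proof (rule balanced_receiver_in_play)
  show "global_type G" using assms by (blast dest: global_type_GOutD)
  show "balanced G (M \<cdot> qmsg p l q)" using assms by (blast dest: balanced_GOutD(1))
  show "chan p q (M \<cdot> qmsg p l q) \<noteq> []" by (simp add: chan_qmsg)
qed

section \<open>Boundedness\<close>

lemma play_comms_Nil [simp]: "play_comms [] = {}"
  by (simp add: play_comms_def)

lemma play_comms_Cons [simp]: "play_comms (\<beta> # \<tau>) = play_comm \<beta> \<union> play_comms \<tau>"
  by (simp add: play_comms_def)

lemma first_at_Nil: "\<not> first_at [] r n"
  by (simp add: first_at_def)

lemma first_at_Cons:
  "first_at (\<beta> # \<tau>) r n \<longleftrightarrow>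
    (if r \<in> play_comm \<beta> then n = 1 else \<exists>m. n = Suc m \<and> first_at \<tau> r m)" (is "?L \<longleftrightarrow> ?R")
proof
  assume ?L
  then obtain \<tau>\<^sub>1 \<gamma> \<tau>\<^sub>2 where *: "\<beta> # \<tau> = \<tau>\<^sub>1 @ [\<gamma>] @ \<tau>\<^sub>2" "n = length \<tau>\<^sub>1 + 1"
    "r \<notin> play_comms \<tau>\<^sub>1" "r \<in> play_comm \<gamma>"
    unfolding first_at_def by blast
  show ?R
  proof (cases \<tau>\<^sub>1)
    case Nil
    then show ?thesis using * by simp
  next
    case (Cons \<beta>' \<tau>')
    then have "first_at \<tau> r (length \<tau>\<^sub>1)" using * unfolding first_at_def by fastforce
    then show ?thesis using * Cons by simp
  qed
next
  assume R: ?R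
  show ?L
  proof (cases "r \<in> play_comm \<beta>")
    case True
    then show ?thesis
      unfolding first_at_def using R
      by (intro exI[of _ "[]"] exI[of _ \<beta>] exI[of _ \<tau>]) simp
  next
    case False
    then obtain m where m: "n = Suc m" "first_at \<tau> r m" using R by auto
    then obtain \<tau>\<^sub>1 \<gamma> \<tau>\<^sub>2 where "\<tau> = \<tau>\<^sub>1 @ [\<gamma>] @ \<tau>\<^sub>2" "m = length \<tau>\<^sub>1 + 1"
      "r \<notin> play_comms \<tau>\<^sub>1" "r \<in> play_comm \<gamma>"
      unfolding first_at_def by blast
    then have "\<beta> # \<tau> = (\<beta> # \<tau>\<^sub>1) @ [\<gamma>] @ \<tau>\<^sub>2 \<and> n = length (\<beta> # \<tau>\<^sub>1) + 1 \<and>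
        r \<notin> play_comms (\<beta> # \<tau>\<^sub>1) \<and> r \<in> play_comm \<gamma>"
      using m False by simp
    then show ?thesis unfolding first_at_def by blast
  qed
qed

lemma first_at_unique: "first_at \<tau> r n \<Longrightarrow> first_at \<tau> r m \<Longrightarrow> n = m"
  by (induction \<tau> arbitrary: n m) (auto simp: first_at_Nil first_at_Cons split: if_splits)

lemma ex_first_at_iff: "(\<exists>n. first_at \<tau> r n) \<longleftrightarrow> r \<in> play_comms \<tau>"
  by (induction \<tau>) (auto simp: first_at_Nil first_at_Cons)

lemma trace_ord_eqI: "first_at \<tau> r n \<Longrightarrow> trace_ord \<tau> r = n"
  unfolding trace_ord_def using first_at_unique by (metis the_equality)

lemma trace_ord_notin: "r \<notin> play_comms \<tau> \<Longrightarrow> trace_ord \<tau> r = 0"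
  using ex_first_at_iff[of \<tau> r] by (auto simp: trace_ord_def)

lemma trace_ord_Cons:
  "trace_ord (\<beta> # \<tau>) r =
    (if r \<in> play_comm \<beta> then 1 else if r \<in> play_comms \<tau> then Suc (trace_ord \<tau> r) else 0)"
proof (cases "r \<in> play_comm \<beta> \<or> r \<notin> play_comms \<tau>")
  case True
  then show ?thesis
    by (auto intro!: trace_ord_eqI trace_ord_notin simp: first_at_Cons)
next
  case False
  then obtain n where "first_at \<tau> r n" using ex_first_at_iff[of \<tau> r] by auto
  moreover from this False have "first_at (\<beta> # \<tau>) r (Suc n)" by (simp add: first_at_Cons)
  ultimately show ?thesis using False by (simp add: trace_ord_eqI)
qed

lemma trace_ord_pos: "r \<in> play_comms \<tau> \<Longrightarrow> 0 < trace_ord \<tau> r"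
  by (cases \<tau>) (auto simp: trace_ord_Cons)

text \<open>Non-empty branchings matter here: \<open>GOut p q fmempty\<close> has the player
  \<open>p\<close> but no trace.\<close>

lemma in_play_trace:
  assumes "in_play G r" and "global_type G"
  shows "\<exists>\<tau>. is_trace G \<tau> \<and> r \<in> play_comms \<tau>"
  using assms
proof (induction rule: in_play.induct)
  case (1 p q B)
  obtain l G where "fmlookup B l = Some G"
    using 1 by (rule global_type_GOut_nonempty)
  then have "is_trace (GOut p q B) [OutC p q l] \<and> p \<in> play_comms [OutC p q l]"
    by (simp add: is_trace.intros)
  then show ?case by blast
next
  case (2 B l G r p q)
  then obtain \<tau> where "is_trace G \<tau>" "r \<in> play_comms \<tau>" by (blast dest: global_type_GOutD)
  with 2 have "is_trace (GOut p q B) (OutC p q l # \<tau>) \<and> r \<in> play_comms (OutC p q l # \<tau>)"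
    by (simp add: is_trace.intros)
  then show ?case by blast
next
  case (3 p q l G)
  have "is_trace (GIn p q l G) [InC p q l] \<and> q \<in> play_comms [InC p q l]"
    by (simp add: is_trace.intros)
  then show ?case by blast
next
  case (4 G r p q l)
  then obtain \<tau> where "is_trace G \<tau>" "r \<in> play_comms \<tau>" by (blast dest: global_type_GInD)
  then have "is_trace (GIn p q l G) (InC p q l # \<tau>) \<and> r \<in> play_comms (InC p q l # \<tau>)"
    by (simp add: is_trace.intros)
  then show ?case by blast
qed

lemma is_trace_play: "is_trace G \<tau> \<Longrightarrow> play_comms \<tau> \<subseteq> play G"
  by (induction rule: is_trace.induct) (simp_all add: subset_iff play_GOut, blast)

text \<open>\<open>depth_finite G r\<close> characterises \<open>gdepth G r < \<infinity>\<close> (for a global type \<open>G\<close>) in a form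
  suited to induction.\<close>

inductive depth_finite :: "('p, 'l) gtype \<Rightarrow> 'p \<Rightarrow> bool" where
  depth_notin: "r \<notin> play G \<Longrightarrow> depth_finite G r"
| depth_Out: "depth_finite (GOut r q B) r"
| depth_In: "depth_finite (GIn p r l G) r"
| depth_Out_child: "(\<And>l G. fmlookup B l = Some G \<Longrightarrow> depth_finite G r) \<Longrightarrow> depth_finite (GOut p q B) r"
| depth_In_child: "depth_finite G r \<Longrightarrow> depth_finite (GIn p q l G) r"

text \<open>Passing to a child lowers the bound by one as long as \<open>r\<close> does not play at
  the root. At bound 0 no trace contains \<open>r\<close>, because positions count from 1 and 0 is
  the default value of \<open>trace_ord\<close>.\<close>

lemma depth_finite_if_bounded:
  assumes "global_type G" and "\<And>\<tau>. is_trace G \<tau> \<Longrightarrow> trace_ord \<tau> r \<le> n"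
  shows "depth_finite G r"
  using assms
proof (induction n arbitrary: G)
  case 0
  have "r \<notin> play G"
  proof
    assume "r \<in> play G"
    then obtain \<tau> where "is_trace G \<tau>" "r \<in> play_comms \<tau>"
      using in_play_trace 0(1) by (fastforce simp: play_def)
    then show False using 0(2)[of \<tau>] trace_ord_pos by fastforce
  qed
  then show ?case by (rule depth_notin)
next
  case (Suc n)
  show ?case
  proof (cases G)
    case (GOut p q B)
    show ?thesis
    proof (cases "r = p")
      case True
      then show ?thesis using GOut depth_Out by simp
    next
      case False
      have "depth_finite H r" if H: "fmlookup B l = Some H" for l H
      proof (rule Suc.IH)
        show "global_type H" using Suc.prems(1) H unfolding GOut by (rule global_type_GOutD)
        fix \<tau>
        assume "is_trace H \<tau>"
        then have "is_trace G (OutC p q l # \<tau>)" using H by (simp add: GOut is_trace.intros)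
        from Suc.prems(2)[OF this] show "trace_ord \<tau> r \<le> n"
          using False trace_ord_notin[of r \<tau>] by (auto simp: trace_ord_Cons split: if_splits)
      qed
      then show ?thesis unfolding GOut by (rule depth_Out_child)
    qed
  next
    case (GIn p q l H)
    show ?thesis
    proof (cases "r = q")
      case True
      then show ?thesis using GIn depth_In by simp
    next
      case False
      have "depth_finite H r"
      proof (rule Suc.IH)
        show "global_type H" using Suc.prems(1) unfolding GIn by (rule global_type_GInD)
        fix \<tau>
        assume "is_trace H \<tau>"
        then have "is_trace G (InC p q l # \<tau>)" by (simp add: GIn is_trace.intros)
        from Suc.prems(2)[OF this] show "trace_ord \<tau> r \<le> n"
          using False trace_ord_notin[of r \<tau>] by (auto simp: trace_ord_Cons split: if_splits)
      qed
      then show ?thesis unfolding GIn by (rule depth_In_child)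
    qed
  next
    case End
    then show ?thesis by (simp add: depth_notin)
  qed
qed

lemma bounded_if_depth_finite:
  assumes "depth_finite G r"
  shows "\<exists>n. \<forall>\<tau>. is_trace G \<tau> \<longrightarrow> trace_ord \<tau> r \<le> n"
  using assms
proof (induction rule: depth_finite.induct)
  case (depth_notin r G)
  then have "trace_ord \<tau> r = 0" if "is_trace G \<tau>" for \<tau>
    using is_trace_play[OF that] by (intro trace_ord_notin) blast
  then show ?case by auto
next
  case (depth_Out r q B)
  have "trace_ord \<tau> r \<le> 1" if "is_trace (GOut r q B) \<tau>" for \<tau>
    using that by cases (simp_all add: trace_ord_Cons)
  then show ?case by blast
next
  case (depth_In p r l G)
  have "trace_ord \<tau> r \<le> 1" if "is_trace (GIn p r l G) \<tau>" for \<tau>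
    using that by cases (simp_all add: trace_ord_Cons)
  then show ?case by blast
next
  case (depth_Out_child B r p q)
  then have "\<forall>l. \<exists>n. \<forall>G \<tau>. fmlookup B l = Some G \<longrightarrow> is_trace G \<tau> \<longrightarrow> trace_ord \<tau> r \<le> n"
    by (metis option.inject)
  from choice[OF this] obtain f where
    f: "\<And>l G \<tau>. fmlookup B l = Some G \<Longrightarrow> is_trace G \<tau> \<Longrightarrow> trace_ord \<tau> r \<le> f l"
    by blast
  \<comment> \<open>The sum over the finite branching dominates every single bound
    \<open>f l\<close>; \<open>Suc\<close> accounts for the communication at the root.\<close>
  have "trace_ord \<tau> r \<le> Suc (\<Sum>l\<in>fmdom' B. f l)" if "is_trace (GOut p q B) \<tau>" for \<tau>
    using that
  proof cases
    case (1 l G)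
    then show ?thesis by (simp add: trace_ord_Cons)
  next
    case (2 l G \<tau>')
    then have "trace_ord \<tau>' r \<le> f l" using f by blast
    also have "f l \<le> (\<Sum>l\<in>fmdom' B. f l)"
      using 2 by (intro member_le_sum) (auto simp: fmlookup_dom'_iff)
    finally show ?thesis using 2 by (simp add: trace_ord_Cons)
  qed
  then show ?case by blast
next
  case (depth_In_child G r p q l)
  then obtain n where n: "\<And>\<tau>. is_trace G \<tau> \<Longrightarrow> trace_ord \<tau> r \<le> n" by blast
  have "trace_ord \<tau> r \<le> Suc n" if "is_trace (GIn p q l G) \<tau>" for \<tau>
    using that by cases (auto simp: trace_ord_Cons dest: n)
  then show ?case by blast
qed

lemma gdepth_finite_iff:
  assumes "global_type G"
  shows "gdepth G r < \<infinity> \<longleftrightarrow> depth_finite G r"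
proof (cases "r \<in> play G")
  case True
  show ?thesis
  proof
    assume "gdepth G r < \<infinity>"
    then obtain n where "gdepth G r = enat n" by auto
    then have n: "(SUP \<tau>\<in>Tr G. enat (trace_ord \<tau> r)) = enat n" using True by (simp add: gdepth_def)
    have "trace_ord \<tau> r \<le> n" if "is_trace G \<tau>" for \<tau>
    proof -
      have "enat (trace_ord \<tau> r) \<le> (SUP \<tau>\<in>Tr G. enat (trace_ord \<tau> r))"
        using that by (intro SUP_upper) (simp add: Tr_def)
      then show ?thesis by (simp add: n)
    qed
    with assms show "depth_finite G r" by (rule depth_finite_if_bounded)
  next
    assume "depth_finite G r"
    from bounded_if_depth_finite[OF this] obtain n
      where "\<And>\<tau>. is_trace G \<tau> \<Longrightarrow> trace_ord \<tau> r \<le> n"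
      by blast
    then have "gdepth G r \<le> enat n"
      using True by (auto simp: gdepth_def Tr_def intro!: SUP_least)
    then show "gdepth G r < \<infinity>" by (rule le_less_trans) simp
  qed
next
  case False
  then show ?thesis by (simp add: gdepth_def depth_notin zero_enat_def)
qed

lemma gbounded_depth_finite: "global_type G \<Longrightarrow> gbounded G \<Longrightarrow> depth_finite G r"
  using gdepth_finite_iff[of G r] subtrees_refl[of G] unfolding gbounded_def by blast

lemma gbounded_gchild: "gbounded G \<Longrightarrow> gchild G H \<Longrightarrow> gbounded H"
  using subtrees_gchild[of G H] unfolding gbounded_def by blast

lemma gbounded_GOutD: "gbounded (GOut p q B) \<Longrightarrow> fmlookup B l = Some G \<Longrightarrow> gbounded G"
  by (rule gbounded_gchild[OF _ gchild.intros(1)])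

lemma gbounded_GInD: "gbounded (GIn p q l G) \<Longrightarrow> gbounded G"
  by (rule gbounded_gchild[OF _ gchild.intros(2)])

text \<open>The root is the only subtree that need not lie below a child, and the rules of
  \<open>depth_finite\<close> lift finiteness from the children to it.\<close>

lemma gboundedI:
  assumes "global_type G" and "\<And>H. gchild G H \<Longrightarrow> gbounded H"
  shows "gbounded G"
proof -
  have children: "depth_finite H r" if "gchild G H" for H r
    using global_type_gchild[OF assms(1) that] assms(2)[OF that] by (rule gbounded_depth_finite)
  have "depth_finite G r" for r
  proof (cases G)
    case (GOut p q B)
    with children show ?thesis
      by (auto simp: gchild_GOut intro!: depth_Out_child)
  next
    case (GIn p q l H)
    with children show ?thesis
      by (auto simp: gchild_GIn intro!: depth_In_child)
  qed (simp add: depth_notin)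
  then have "gdepth G r < \<infinity>" for r using gdepth_finite_iff[OF assms(1)] by blast
  then show ?thesis
    using assms(2) unfolding gbounded_def by (subst subtrees_unfold) blast
qed

lemma type_step_gbounded:
  assumes "type_step (G, M) \<beta> (G', M')" and "global_type G" and "gbounded G"
  shows "gbounded G'"
  using assms
proof (induction "(G, M)" \<beta> "(G', M')" arbitrary: G M G' M')
  case (Ext_Out B l G p q M)
  then show ?case by (blast dest: gbounded_GOutD)
next
  case (Ext_In p q l G M)
  then show ?case by (blast dest: gbounded_GInD)
next
  case (IComm_Out B' B M p q \<beta> M')
  have step: "type_step (GOut p q B, M) \<beta> (GOut p q B', M')"
    using IComm_Out.hyps(1,2,4) by (rule type_step.IComm_Out)
  show ?case
  proof (rule gboundedI)
    show "global_type (GOut p q B')" using step IComm_Out.prems(1) by (rule type_step_global_type)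
    fix H'
    assume "gchild (GOut p q B') H'"
    then obtain l where H': "fmlookup B' l = Some H'" by (auto simp: gchild_GOut)
    then obtain H where H: "fmlookup B l = Some H"
      using IComm_Out.hyps(1) by (metis fmlookup_dom'_iff)
    then show "gbounded H'"
      using IComm_Out.hyps(3)[OF H H'] IComm_Out.prems
      by (blast dest: global_type_GOutD gbounded_GOutD)
  qed
next
  case (IComm_In G M \<beta> G' M' q p l)
  have step: "type_step (GIn p q l G, qmsg p l q \<cdot> M) \<beta> (GIn p q l G', qmsg p l q \<cdot> M')"
    using IComm_In.hyps(1,3) by (rule type_step.IComm_In)
  show ?case
  proof (rule gboundedI)
    show "global_type (GIn p q l G')" using step IComm_In.prems(1) by (rule type_step_global_type)
    show "gbounded H" if "gchild (GIn p q l G') H" for H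
      using that IComm_In.hyps(2) IComm_In.prems
      by (auto simp: gchild_GIn dest: global_type_GInD gbounded_GInD)
  qed
qed

section \<open>Processes\<close>

lemma prefix_actions_Nil [simp]: "prefix_actions [] P = P"
  by (simp add: prefix_actions_def)

lemma prefix_actions_Cons [simp]: "prefix_actions (a # \<pi>) P = prefix_action a (prefix_actions \<pi> P)"
  by (simp add: prefix_actions_def)

lemma proc_child_Send: "proc_child (Send q C) P \<longleftrightarrow> (\<exists>l. fmlookup C l = Some P)"
  by (subst proc_child.simps) auto

lemma proc_child_Recv: "proc_child (Recv q C) P \<longleftrightarrow> (\<exists>l. fmlookup C l = Some P)"
  by (subst proc_child.simps) auto

lemma proc_child_Inact: "\<not> proc_child Inact P"
  by (subst proc_child.simps) auto

lemma process_proc_child: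
  assumes "process P" and "proc_child P Q"
  shows "process Q"
proof -
  have "proc_subterms Q \<subseteq> proc_subterms P"
    using assms(2) unfolding proc_subterms_def by (blast intro: converse_rtranclp_into_rtranclp)
  then show ?thesis using assms(1) finite_subset unfolding process_def by blast
qed

lemma process_SendD: "process (Send q C) \<Longrightarrow> fmlookup C l = Some P \<Longrightarrow> process P"
  by (rule process_proc_child[OF _ proc_child.intros(1)])

lemma process_RecvD: "process (Recv q C) \<Longrightarrow> fmlookup C l = Some P \<Longrightarrow> process P"
  by (rule process_proc_child[OF _ proc_child.intros(2)])

lemma proc_le_SendE:
  assumes "P \<preceq> Send q C"
  obtains B where "P = Send q B" "fmdom' B = fmdom' C"
    "\<And>l P Q. fmlookup B l = Some P \<Longrightarrow> fmlookup C l = Some Q \<Longrightarrow> P \<preceq> Q"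
  using assms by (cases rule: proc_le.cases) (auto intro: that)

lemma proc_le_RecvE:
  assumes "P \<preceq> Recv q C"
  obtains B where "P = Recv q B" "fmdom' C \<subseteq> fmdom' B"
    "\<And>l P Q. fmlookup B l = Some P \<Longrightarrow> fmlookup C l = Some Q \<Longrightarrow> P \<preceq> Q"
  using assms by (cases rule: proc_le.cases) (auto intro: that)

lemma proc_le_InactD: "P \<preceq> Inact \<Longrightarrow> P = Inact"
  by (cases rule: proc_le.cases) auto

lemma proc_le_trans:
  assumes "P \<preceq> Q" and "Q \<preceq> R"
  shows "P \<preceq> R"
proof -
  have "\<exists>Q. P \<preceq> Q \<and> Q \<preceq> R" using assms by blast
  then show ?thesis
  proof (coinduction arbitrary: P R)
    case proc_le
    then obtain Q where PQ: "P \<preceq> Q" and QR: "Q \<preceq> R" by blast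
    show ?case
    proof (cases R)
      case (Send q D)
      from QR[unfolded Send] obtain C where C: "Q = Send q C" "fmdom' C = fmdom' D"
        "\<And>l P Q. fmlookup C l = Some P \<Longrightarrow> fmlookup D l = Some Q \<Longrightarrow> P \<preceq> Q"
        by (rule proc_le_SendE) blast
      from PQ[unfolded C(1)] obtain B where B: "P = Send q B" "fmdom' B = fmdom' C"
        "\<And>l P Q. fmlookup B l = Some P \<Longrightarrow> fmlookup C l = Some Q \<Longrightarrow> P \<preceq> Q"
        by (rule proc_le_SendE) blast
      have "\<exists>Q. X \<preceq> Q \<and> Q \<preceq> Y" if X: "fmlookup B l = Some X" and Y: "fmlookup D l = Some Y" for l X Y
      proof -
        obtain Z where "fmlookup C l = Some Z" using Y C(2) by (metis fmlookup_dom'_iff)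
        then show ?thesis using X Y B(3) C(3) by blast
      qed
      then show ?thesis using B C Send by auto
    next
      case (Recv q D)
      from QR[unfolded Recv] obtain C where C: "Q = Recv q C" "fmdom' D \<subseteq> fmdom' C"
        "\<And>l P Q. fmlookup C l = Some P \<Longrightarrow> fmlookup D l = Some Q \<Longrightarrow> P \<preceq> Q"
        by (rule proc_le_RecvE) blast
      from PQ[unfolded C(1)] obtain B where B: "P = Recv q B" "fmdom' C \<subseteq> fmdom' B"
        "\<And>l P Q. fmlookup B l = Some P \<Longrightarrow> fmlookup C l = Some Q \<Longrightarrow> P \<preceq> Q"
        by (rule proc_le_RecvE) blast
      have "\<exists>Q. X \<preceq> Q \<and> Q \<preceq> Y" if X: "fmlookup B l = Some X" and Y: "fmlookup D l = Some Y" for l X Y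
      proof -
        have "l \<in> fmdom' C" using Y C(2) by (auto intro: fmdom'I)
        then obtain Z where "fmlookup C l = Some Z" by (metis fmlookup_dom'_iff)
        then show ?thesis using X Y B(3) C(3) by blast
      qed
      then show ?thesis using B C Recv by auto
    next
      case Inact
      then have "Q = Inact" using QR by (simp add: proc_le_InactD)
      then have "P = Inact" using PQ by (simp add: proc_le_InactD)
      then show ?thesis using Inact by simp
    qed
  qed
qed

text \<open>\<open>narrow p l (Some m) P\<close> keeps, on each path of \<open>P\<close>, only the branch \<open>l\<close> of the \<open>m\<close>-th input
  from \<open>p\<close> (counting from \<open>0\<close>), if there is one.  This is what happens to the projection onto
  the receiver when \<open>p\<close> chooses to send \<open>l\<close> while \<open>m\<close> messages to that receiver are still queued.
  The state \<open>None\<close> means that this input has been passed.\<close>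

definition next_state :: "'p \<Rightarrow> 'p \<Rightarrow> nat option \<Rightarrow> nat option" where
  "next_state p q s = (if q = p then case s of Some (Suc m) \<Rightarrow> Some m | _ \<Rightarrow> None else s)"

definition pick :: "'p \<Rightarrow> 'l \<Rightarrow> 'p \<Rightarrow> nat option \<Rightarrow> ('l, 'a) fmap \<Rightarrow> ('l, 'a) fmap" where
  "pick p l q s C = (if q = p \<and> s = Some 0 \<and> l \<in> fmdom' C then fmrestrict_set {l} C else C)"

primcorec narrow :: "'p \<Rightarrow> 'l \<Rightarrow> nat option \<Rightarrow> ('p, 'l) proc \<Rightarrow> ('p, 'l) proc" where
  "narrow p l s P = (case P of
     Send q C \<Rightarrow> Send q (fmmap (narrow p l s) C)
   | Recv q C \<Rightarrow> Recv q (fmmap (narrow p l (next_state p q s)) (pick p l q s C))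
   | Inact \<Rightarrow> Inact)"

lemma narrow_Send [simp]: "narrow p l s (Send q C) = Send q (fmmap (narrow p l s) C)"
  by (subst narrow.code) simp

lemma narrow_Recv [simp]:
  "narrow p l s (Recv q C) = Recv q (fmmap (narrow p l (next_state p q s)) (pick p l q s C))"
  by (subst narrow.code) simp

lemma narrow_Inact [simp]: "narrow p l s Inact = Inact"
  by (subst narrow.code) simp

lemma fmlookup_pick: "fmlookup (pick p l q s C) k = Some X \<Longrightarrow> fmlookup C k = Some X"
  by (auto simp: pick_def split: if_splits)

lemma fmdom'_pick: "fmdom' (pick p l q s C) \<subseteq> fmdom' C"
  by (auto simp: pick_def fmlookup_dom'_iff split: if_splits)

lemma fmmap_singleton [simp]: "fmmap f (fmupd k X fmempty) = fmupd k (f X) fmempty"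
  by (rule fmap_ext) simp

lemma pick_singleton [simp]: "pick p l q s (fmupd k X fmempty) = fmupd k X fmempty"
  by (auto simp: pick_def intro: fmap_ext)

text \<open>The guard \<open>l \<in> fmdom' C\<close> in \<open>pick\<close> keeps the cut from
  emptying a branching, which \<open>process\<close> would forbid.\<close>

lemma pick_fmempty_iff [simp]: "pick p l q s C = fmempty \<longleftrightarrow> C = fmempty"
proof
  assume *: "pick p l q s C = fmempty"
  show "C = fmempty"
  proof (cases "q = p \<and> s = Some 0 \<and> l \<in> fmdom' C")
    case True
    then have "fmlookup (pick p l q s C) l \<noteq> None"
      by (auto simp: pick_def fmlookup_dom'_iff)
    then show ?thesis using * by simp
  qed (use * in \<open>auto simp: pick_def\<close>)
qed (simp add: pick_def)

lemma fmmap_fmempty_iff: "fmmap f C = fmempty \<longleftrightarrow> C = fmempty"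
proof
  assume "fmmap f C = fmempty"
  then have "map_option f (fmlookup C l) = None" for l by (metis fmlookup_map fmempty_lookup)
  then show "C = fmempty" by (intro fmap_ext) simp
qed simp

lemma proc_le_narrow: "P \<preceq> narrow p l s P"
proof (coinduction arbitrary: P s)
  case proc_le
  show ?case
  proof (cases P)
    case (Recv q C)
    have "\<exists>P' s'. xa = P' \<and> xb = narrow p l s' P'"
      if "fmlookup C x = Some xa" "fmlookup (fmmap (narrow p l (next_state p q s)) (pick p l q s C)) x = Some xb"
      for x xa xb
      using that fmlookup_pick by fastforce
    then show ?thesis using Recv fmdom'_pick[of p l q s C] by auto
  qed auto
qed

text \<open>The counter never grows, so only finitely many states are reachable, and every subterm
  of the result is a narrowing of a subterm of \<open>P\<close> in one of them.\<close>

lemma process_narrow: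
  assumes "process P"
  shows "process (narrow p l s P)"
proof -
  \<comment> \<open>This set contains \<open>s\<close> and is closed under
    \<open>next_state\<close>; for \<open>s = None\<close> the default 0 merely adds
    \<open>Some 0\<close>.\<close>
  define S where "S = insert None (Some ` {..case s of None \<Rightarrow> 0 | Some m \<Rightarrow> m})"
  have S: "next_state p q t \<in> S" if "t \<in> S" for q t
    using that unfolding S_def next_state_def by (cases s) (auto split: option.splits nat.splits)
  have sub: "\<exists>t\<in>S. \<exists>R. proc_child\<^sup>*\<^sup>* P R \<and> Q = narrow p l t R"
    if "proc_child\<^sup>*\<^sup>* (narrow p l s P) Q" for Q
    using that
  proof (induction rule: rtranclp_induct)
    case base
    have "s \<in> S" by (cases s) (auto simp: S_def)
    then show ?case by blast
  next
    case (step Q Q')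
    then obtain t R where t: "t \<in> S" "proc_child\<^sup>*\<^sup>* P R" "Q = narrow p l t R" by blast
    have "\<exists>t'\<in>S. \<exists>R'. proc_child R R' \<and> Q' = narrow p l t' R'"
    proof (cases R)
      case (Send q C)
      then show ?thesis using step.hyps(2) t by (auto simp: proc_child_Send)
    next
      case (Recv q C)
      then obtain k X where "fmlookup (pick p l q t C) k = Some X"
        "Q' = narrow p l (next_state p q t) X"
        using step.hyps(2) t by (auto simp: proc_child_Recv)
      moreover have "next_state p q t \<in> S" using t S by blast
      ultimately show ?thesis using Recv fmlookup_pick proc_child_Recv by metis
    next
      case Inact
      then show ?thesis using step.hyps(2) t by (simp add: proc_child_Inact)
    qed
    then show ?case using t(2) by (meson rtranclp.rtrancl_into_rtrancl)
  qed
  have "finite S" by (simp add: S_def)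
  have "finite (proc_subterms P)" using assms by (simp add: process_def)
  then have "finite ((\<lambda>(t, R). narrow p l t R) ` (S \<times> proc_subterms P))"
    using \<open>finite S\<close> by blast
  moreover have "proc_subterms (narrow p l s P) \<subseteq> (\<lambda>(t, R). narrow p l t R) ` (S \<times> proc_subterms P)"
    using sub unfolding proc_subterms_def by fastforce
  ultimately have "finite (proc_subterms (narrow p l s P))" using finite_subset by blast
  moreover have "B \<noteq> fmempty"
    if B: "Send q B \<in> proc_subterms (narrow p l s P) \<or> Recv q B \<in> proc_subterms (narrow p l s P)" for q B
  proof -
    obtain t R where R: "R \<in> proc_subterms P" "Send q B = narrow p l t R \<or> Recv q B = narrow p l t R"
      using B sub unfolding proc_subterms_def by blast
    then show ?thesis
      using assms unfolding process_def by (cases R) (auto simp: fmmap_fmempty_iff)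
  qed
  ultimately show ?thesis unfolding process_def by blast
qed

primrec advance :: "'p \<Rightarrow> ('p, 'l) action list \<Rightarrow> nat option \<Rightarrow> nat option" where
  "advance p [] s = s"
| "advance p (a # \<pi>) s = advance p \<pi> (case a of SendA q k \<Rightarrow> s | RecvA q k \<Rightarrow> next_state p q s)"

lemma narrow_prefix_actions:
  "narrow p l s (prefix_actions \<pi> P) = prefix_actions \<pi> (narrow p l (advance p \<pi> s) P)"
proof (induction \<pi> arbitrary: s)
  case (Cons a \<pi>)
  then show ?case by (cases a) simp_all
qed simp

text \<open>The labels \<open>w\<close> of the messages queued from \<open>p\<close> force the first inputs from \<open>p\<close>.  The bound
  \<open>n\<close> on the depth replaces a coinductive definition, because the continuations of a projection
  need not be projections when the receiver of a choice is concerned.\<close>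

primrec reads :: "nat \<Rightarrow> 'p \<Rightarrow> 'l list \<Rightarrow> ('p, 'l) proc \<Rightarrow> bool" where
  "reads 0 p w P = True"
| "reads (Suc n) p w P = (w = [] \<or> (case P of
     Send q C \<Rightarrow> \<forall>k X. fmlookup C k = Some X \<longrightarrow> reads n p w X
   | Recv q C \<Rightarrow> \<forall>k X. fmlookup C k = Some X \<longrightarrow>
       (if q = p then k = hd w \<and> reads n p (tl w) X else reads n p w X)
   | Inact \<Rightarrow> True))"

lemma reads_Nil [simp]: "reads n p [] P"
  by (cases n) simp_all

lemma reads_Inact [simp]: "reads n p w Inact"
  by (cases n) simp_all

lemma reads_Recv_singleton:
  "reads (Suc n) p w (Recv q (fmupd k X fmempty)) \<longleftrightarrow>
    w = [] \<or> (if q = p then k = hd w \<and> reads n p (tl w) X else reads n p w X)"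
  by (simp split: if_splits)

lemma reads_append: "reads n p (w @ v) P \<Longrightarrow> reads n p w P"
proof (induction n arbitrary: w P)
  case (Suc n)
  show ?case
  proof (cases "w = []")
    case False
    then have "hd (w @ v) = hd w" "tl (w @ v) = tl w @ v" by simp_all
    with False Suc show ?thesis by (cases P) (auto split: if_splits)
  qed simp
qed simp

text \<open>The state counts the queued labels \<open>w\<close> still to be read. If these and then
  \<open>l\<close> are forced, the input met in state \<open>Some 0\<close> offers no label but
  \<open>l\<close>, and the cut removes nothing. All depths \<open>n\<close> are assumed because the
  coinduction descends without bound.\<close>

lemma narrow_id:
  assumes "s = None \<or> (\<exists>w. s = Some (length w) \<and> (\<forall>n. reads n p (w @ [l]) P))"
  shows "narrow p l s P = P"
  using assms
proof (coinduction arbitrary: s P rule: proc.coinduct)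
  case Eq_proc
  show ?case
  proof (cases P)
    case (Send q C)
    have same_ok: "s = None \<or> (\<exists>w. s = Some (length w) \<and> (\<forall>n. reads n p (w @ [l]) X))"
      if X: "fmlookup C k = Some X" for k X
    proof (rule disjE[OF Eq_proc])
      assume "\<exists>w. s = Some (length w) \<and> (\<forall>n. reads n p (w @ [l]) P)"
      then obtain w where w: "s = Some (length w)" "\<And>n. reads (Suc n) p (w @ [l]) P" by blast
      then have "reads n p (w @ [l]) X" for n using w(2)[of n] X Send by auto
      then show ?thesis using w(1) by blast
    qed simp
    have "rel_option (\<lambda>P' P. \<exists>s. P' = narrow p l s P \<and>
        (s = None \<or> (\<exists>w. s = Some (length w) \<and> (\<forall>n. reads n p (w @ [l]) P))))
        (map_option (narrow p l s) (fmlookup C k)) (fmlookup C k)" for k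
    proof (cases "fmlookup C k")
      case (Some X)
      then show ?thesis using same_ok[OF Some] by (auto intro!: exI[of _ s])
    qed simp
    then have "fmrel (\<lambda>P' P. \<exists>s. P' = narrow p l s P \<and>
        (s = None \<or> (\<exists>w. s = Some (length w) \<and> (\<forall>n. reads n p (w @ [l]) P)))) (fmmap (narrow p l s) C) C"
      by (simp add: fmrel_iff)
    then show ?thesis using Send by simp
  next
    case (Recv q C)
    have next_ok: "next_state p q s = None \<or>
        (\<exists>w. next_state p q s = Some (length w) \<and> (\<forall>n. reads n p (w @ [l]) X))"
      if X: "fmlookup C k = Some X" for k X
    proof (rule disjE[OF Eq_proc])
      assume "\<exists>w. s = Some (length w) \<and> (\<forall>n. reads n p (w @ [l]) P)"
      then obtain w where w: "s = Some (length w)" "\<And>n. reads (Suc n) p (w @ [l]) P" by blast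
      show ?thesis
      proof (cases "q = p")
        case True
        show ?thesis
        proof (cases w)
          case (Cons a v)
          then have "reads n p (v @ [l]) X" for n using w(2)[of n] X Recv True by auto
          then show ?thesis using w(1) True Cons by (auto simp: next_state_def)
        qed (use w(1) True in \<open>simp add: next_state_def\<close>)
      next
        case False
        then have "reads n p (w @ [l]) X" for n using w(2)[of n] X Recv by auto
        then show ?thesis using w(1) False by (auto simp: next_state_def)
      qed
    qed (simp add: next_state_def)
    have "pick p l q s C = C"
    proof (cases "q = p \<and> s = Some 0 \<and> l \<in> fmdom' C")
      case True
      \<comment> \<open>State \<open>Some 0\<close> means \<open>w = []\<close>, so one level of
        \<open>reads\<close> already forces every label here to be \<open>l\<close>.\<close>
      then have "reads (Suc 0) p [l] P" using Eq_proc by auto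
      then have "k = l" if "fmlookup C k = Some X" for k X using that True Recv by auto
      then have "fmrestrict_set {l} C = C" by (intro fmap_ext) (auto, metis not_None_eq)
      then show ?thesis by (simp add: pick_def)
    next
      case False
      then show ?thesis unfolding pick_def by (rule if_not_P)
    qed
    moreover have "rel_option (\<lambda>P' P. \<exists>s. P' = narrow p l s P \<and>
        (s = None \<or> (\<exists>w. s = Some (length w) \<and> (\<forall>n. reads n p (w @ [l]) P))))
        (map_option (narrow p l (next_state p q s)) (fmlookup C k)) (fmlookup C k)" for k
    proof (cases "fmlookup C k")
      case (Some X)
      then show ?thesis using next_ok[OF Some] by (auto intro!: exI[of _ "next_state p q s"])
    qed simp
    ultimately show ?thesis using Recv by (simp add: fmrel_iff)
  qed simp
qed

text \<open>The branches share the prefix, so the labels forced in it can be checked in any one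
  branch, whence \<open>C \<noteq> fmempty\<close>. The input from \<open>q\<close> that follows
  hands the remaining word unchanged to every continuation.\<close>

lemma reads_prefix_actions_other:
  assumes "q \<noteq> p" and "C \<noteq> fmempty"
    and "\<And>k X. fmlookup C k = Some X \<Longrightarrow> reads n p w (prefix_actions \<pi> (Recv q (fmupd k X fmempty)))"
  shows "reads n p w (prefix_actions \<pi> (Recv q C))"
proof -
  obtain k\<^sub>0 X\<^sub>0 where k0: "fmlookup C k\<^sub>0 = Some X\<^sub>0"
    using assms(2) by (metis fmap_ext fmempty_lookup not_None_eq)
  show ?thesis
    using assms(3)
  proof (induction \<pi> arbitrary: n w)
    case Nil
    show ?case
    proof (cases n)
      case (Suc m)
      have "w = [] \<or> reads m p w X" if "fmlookup C k = Some X" for k X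
        using Nil[OF that] assms(1) Suc by auto
      then show ?thesis using assms(1) Suc by auto
    qed simp
  next
    case (Cons a \<pi>)
    show ?case
    proof (cases "n = 0 \<or> w = []")
      case False
      then obtain m b v where n: "n = Suc m" and w: "w = b # v" by (meson list.exhaust not0_implies_Suc)
      show ?thesis
      proof (cases a)
        case (SendA r c)
        then show ?thesis using Cons.prems Cons.IH[of m w] by (simp add: n w)
      next
        case (RecvA r c)
        show ?thesis
        proof (cases "r = p")
          case True
          then show ?thesis using RecvA Cons.prems Cons.IH[of m v] k0 by (auto simp: n w)
        next
          case False
          then show ?thesis using RecvA Cons.prems Cons.IH[of m w] by (simp add: n w)
        qed
      qed
    qed auto
  qed
qed

text \<open>If \<open>\<pi>\<close> left a label of \<open>w\<close> unread, both branches
  \<open>a\<close> and \<open>b\<close> would have to carry it. So within the inspected depth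
  \<open>w\<close> is used up inside \<open>\<pi>\<close>, and the choice itself is
  unconstrained.\<close>

lemma reads_prefix_actions_same:
  assumes "fmlookup C a = Some A" and "fmlookup C b = Some B" and "a \<noteq> b"
    and "\<And>k X. fmlookup C k = Some X \<Longrightarrow> reads n p (w @ [k]) (prefix_actions \<pi> (Recv p (fmupd k X fmempty)))"
  shows "reads n p w (prefix_actions \<pi> (Recv p C))"
  using assms(4)
proof (induction \<pi> arbitrary: n w)
  case Nil
  show ?case
  proof (cases "n = 0 \<or> w = []")
    case False
    then obtain m c v where n: "n = Suc m" and w: "w = c # v" by (meson list.exhaust not0_implies_Suc)
    have "a = c" "b = c" using Nil[OF assms(1)] Nil[OF assms(2)] by (simp_all add: n w)
    then show ?thesis using assms(3) by simp
  qed auto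
next
  case (Cons x \<pi>)
  show ?case
  proof (cases "n = 0 \<or> w = []")
    case False
    then obtain m c v where n: "n = Suc m" and w: "w = c # v" by (meson list.exhaust not0_implies_Suc)
    show ?thesis
    proof (cases x)
      case (SendA r d)
      then show ?thesis using Cons.prems Cons.IH[of m w] by (simp add: n w)
    next
      case (RecvA r d)
      show ?thesis
      proof (cases "r = p")
        case True
        then show ?thesis using RecvA Cons.prems Cons.IH[of m v] assms(1) by (auto simp: n w)
      next
        case False
        then show ?thesis using RecvA Cons.prems Cons.IH[of m w] by (simp add: n w)
      qed
    qed
  qed auto
qed

text \<open>Two different labels can follow \<open>w\<close>, so \<open>\<pi>\<close> reads exactly \<open>w\<close> from \<open>p\<close>.\<close>

lemma narrow_prefix_actions_choice:
  assumes "fmlookup C a = Some A" and "fmlookup C b = Some B" and "a \<noteq> b"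
    and "\<And>n k X. fmlookup C k = Some X \<Longrightarrow> reads n p (w @ [k]) (prefix_actions \<pi> (Recv p (fmupd k X fmempty)))"
    and "fmlookup C l = Some P"
  shows "narrow p l (Some (length w)) (prefix_actions \<pi> (Recv p C)) =
    prefix_actions \<pi> (Recv p (fmupd l P fmempty))"
  using assms(4)
proof (induction \<pi> arbitrary: w)
  case Nil
  \<comment> \<open>A label left over after \<open>\<pi>\<close> would be forced on both branches
    \<open>a\<close> and \<open>b\<close>.\<close>
  have "w = []"
  proof (cases w)
    case (Cons c v)
    have "a = c" "b = c" using Nil[OF assms(1), of 1] Nil[OF assms(2), of 1] by (simp_all add: Cons)
    then show ?thesis using assms(3) by simp
  qed
  moreover have "pick p l p (Some 0) C = fmupd l P fmempty"
    using assms(5) by (auto simp: pick_def fmdom'I intro: fmap_ext)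
  ultimately show ?case by (simp add: next_state_def narrow_id)
next
  case (Cons x \<pi>)
  have *: "reads (Suc n) p (w @ [k]) (prefix_actions (x # \<pi>) (Recv p (fmupd k X fmempty)))"
    if "fmlookup C k = Some X" for n k X
    using that by (rule Cons.prems)
  show ?case
  proof (cases x)
    case (SendA r d)
    then show ?thesis using * Cons.IH[of w] by simp
  next
    case (RecvA r d)
    show ?thesis
    proof (cases "r = p")
      case True
      \<comment> \<open>Nor can \<open>\<pi>\<close> read more than \<open>w\<close>: once the word
        is exhausted, the fixed label \<open>d\<close> would have to be \<open>a\<close> for one
        branch and \<open>b\<close> for another.\<close>
      obtain c v where w: "w = c # v"
      proof (cases w)
        case Nil
        have "a = d" "b = d" using *[OF assms(1), of 0] *[OF assms(2), of 0] by (simp_all add: Nil RecvA True reads_Recv_singleton del: reads.simps(2))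
        then show ?thesis using assms(3) by simp
      qed
      have "reads n p (v @ [k]) (prefix_actions \<pi> (Recv p (fmupd k X fmempty)))"
        if "fmlookup C k = Some X" for n k X
        using *[OF that, of n] by (simp add: w RecvA True)
      then show ?thesis using RecvA True Cons.IH[of v] by (simp add: w next_state_def)
    next
      case False
      then show ?thesis using RecvA * Cons.IH[of w] by (simp add: next_state_def)
    qed
  qed
qed

section \<open>Projections\<close>

lemma proj_GOutE:
  assumes "proj (GOut p q B) r P"
  obtains (notin) "r \<notin> play (GOut p q B)" "P = Inact"
  | (sender) C where "r = p" "P = Send q C" "fmdom' C = fmdom' B"
      "\<And>l G P. fmlookup B l = Some G \<Longrightarrow> fmlookup C l = Some P \<Longrightarrow> proj G p P"
  | (single) l G where "r = q" "q \<noteq> p" "B = fmupd l G fmempty" "proj G q P"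
  | (choice) C \<pi> where "r = q" "q \<noteq> p" "card (fmdom' B) > 1" "fmdom' C = fmdom' B"
      "P = prefix_actions \<pi> (Recv p C)"
      "\<And>l G P. fmlookup B l = Some G \<Longrightarrow> fmlookup C l = Some P \<Longrightarrow>
        proj G q (prefix_actions \<pi> (Recv p (fmupd l P fmempty)))"
  | (other) "r \<noteq> p" "r \<noteq> q" "\<And>l G. fmlookup B l = Some G \<Longrightarrow> proj G r P"
  using assms
proof (cases rule: proj.cases)
  case proj_Inact
  then show ?thesis by (intro notin) auto
next
  case (proj_sender C)
  then show ?thesis by (intro sender) auto
next
  case (proj_receiver_single l G)
  then show ?thesis by (intro single) auto
next
  case (proj_receiver_choice C \<pi>)
  then show ?thesis by (intro choice) auto
next
  case (proj_other_Out k G)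
  then show ?thesis by (intro other) auto
qed

lemma proj_GInE:
  assumes "proj (GIn p q l G) r P"
  obtains (notin) "r \<notin> play (GIn p q l G)" "P = Inact"
  | (receiver) Q where "r = q" "P = Recv p (fmupd l Q fmempty)" "proj G q Q"
  | (other) "r \<noteq> q" "proj G r P"
  using assms
proof (cases rule: proj.cases)
  case proj_Inact
  then show ?thesis by (intro notin) auto
next
  case (proj_In Q)
  then show ?thesis by (intro receiver) auto
next
  case proj_other_In
  then show ?thesis by (intro other) auto
qed

lemma fmdom'_eq_lookup:
  assumes "fmdom' B' = fmdom' B" and "fmlookup B' l = Some x"
  obtains y where "fmlookup B l = Some y"
  using assms by (metis fmlookup_dom'_iff)

lemma fmdom'_eq_singleton:
  assumes "fmdom' B' = fmdom' (fmupd l x fmempty)"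
  obtains y where "B' = fmupd l y fmempty" "fmlookup B' l = Some y"
proof -
  obtain y where y: "fmlookup B' l = Some y"
    using assms fmdom'_eq_lookup[of "fmupd l x fmempty" B' l x] by auto
  have "fmlookup B' k = None" if "k \<noteq> l" for k
    using assms that by (metis fmdom'_fmupd fmdom'_empty fmdom'_notD singletonD)
  then have "B' = fmupd l y fmempty" using y by (intro fmap_ext) auto
  then show ?thesis using y that by blast
qed

lemma card_fmdom'_gt_1:
  assumes "card (fmdom' C) > 1"
  obtains a b x y where "a \<noteq> b" "fmlookup C a = Some x" "fmlookup C b = Some y"
proof -
  obtain a b where "a \<in> fmdom' C" "b \<in> fmdom' C" "a \<noteq> b"
    using assms by (metis card.infinite card_le_Suc0_iff_eq not_less One_nat_def less_nat_zero_code)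
  then show ?thesis using that by (metis fmlookup_dom'_iff)
qed

text \<open>The receiver clauses of \<open>proj\<close> carry no guard, but in a balanced type the
  message just sent must be read later, so the receiver does play and these clauses cannot
  apply.\<close>

lemma proj_notin_play:
  assumes "global_type G" and "balanced G M" and "proj G r P" and "r \<notin> play G"
  shows "P = Inact"
proof (cases G)
  case (GOut p q B)
  from assms(3)[unfolded GOut] show ?thesis
  proof (cases rule: proj_GOutE)
    case sender
    then show ?thesis using assms(4) GOut by (simp add: play_GOut)
  next
    case (single l H)
    then have "q \<in> play H"
      using assms(1,2) GOut balanced_GOut_receiver_in_play[of p q B M l H] by simp
    then show ?thesis using assms(4) GOut single by (auto simp: play_GOut)
  next
    case choice
    obtain l H where H: "fmlookup B l = Some H"
      using assms(1)[unfolded GOut] by (rule global_type_GOut_nonempty)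
    then have "q \<in> play H"
      using assms(1,2) GOut balanced_GOut_receiver_in_play[of p q B M l H] by simp
    then show ?thesis using assms(4) GOut choice H by (auto simp: play_GOut)
  next
    case other
    from assms(3)[unfolded GOut] show ?thesis
      by (cases rule: proj.cases) (use assms(4) GOut other in \<open>auto simp: play_GOut\<close>)
  qed
next
  case (GIn p q l H)
  from assms(3)[unfolded GIn] show ?thesis
    by (cases rule: proj.cases) (use assms(4) GIn in auto)
next
  case End
  from assms(3)[unfolded End] show ?thesis by (cases rule: proj.cases) auto
qed

text \<open>Dispenses with finding a branch in which \<open>r\<close> plays: if there is none, all
  branches project to \<open>Inact\<close> and the first clause applies.\<close>

lemma proj_other_OutI:
  assumes "global_type (GOut p q B)" and "balanced (GOut p q B) M"
    and "r \<noteq> p" and "r \<noteq> q" and "\<And>l G. fmlookup B l = Some G \<Longrightarrow> proj G r P"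
  shows "proj (GOut p q B) r P"
proof (cases "\<exists>k H. fmlookup B k = Some H \<and> r \<in> play H")
  case True
  then show ?thesis using assms(3,4,5) by (auto intro: proj_other_Out)
next
  case False
  obtain l G where G: "fmlookup B l = Some G"
    using assms(1) by (rule global_type_GOut_nonempty)
  have "P = Inact"
  proof (rule proj_notin_play)
    show "global_type G" using assms(1) G by (rule global_type_GOutD)
    show "balanced G (M \<cdot> qmsg p l q)" using assms(2) G by (rule balanced_GOutD(1))
    show "proj G r P" using G by (rule assms(5))
    show "r \<notin> play G" using False G by blast
  qed
  moreover have "r \<notin> play (GOut p q B)" using False assms(3) by (auto simp: play_GOut)
  ultimately show ?thesis by (simp add: proj_Inact)
qed

lemma proj_other_InI:
  assumes "global_type (GIn p q l G)" and "balanced (GIn p q l G) M"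
    and "r \<noteq> q" and "proj G r P"
  shows "proj (GIn p q l G) r P"
proof (cases "r \<in> play G")
  case True
  then show ?thesis using assms(3,4) by (intro proj_other_In)
next
  case False
  obtain K where "balanced G K" using assms(2) by (rule balanced_GInD)
  moreover have "global_type G" using assms(1) by (rule global_type_GInD)
  ultimately have "P = Inact" using assms(4) False by (intro proj_notin_play)
  then show ?thesis using False assms(3) by (simp add: proj_Inact)
qed

text \<open>The induction on \<open>n\<close> consumes actions of \<open>r\<close>; the inner one on
  \<open>depth_finite\<close> crosses the nodes that contribute none. Crossing an output can only
  prolong the word on the channel, and a prefix of a forced word is forced; crossing an input of
  another participant leaves the channel alone.\<close>

lemma proj_reads:
  fixes G :: "('p, 'l) gtype"
  assumes "global_type G" and "gbounded G" and "balanced G M" and "proj G r P" and "p \<noteq> r"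
  shows "reads n p (chan p r M) P"
  using assms
proof (induction n arbitrary: G r M P)
  case (Suc n)
  \<comment> \<open>The child rules of \<open>depth_finite\<close> do not exclude that
    \<open>r\<close> plays at the root, so the cases consuming an action of \<open>r\<close> arise
    twice and are stated separately.\<close>
  have sender_case: "reads (Suc n) p (chan p r M) (Send q C)"
    if G: "global_type (GOut r q B)" "gbounded (GOut r q B)" "balanced (GOut r q B) M"
      "fmdom' C = fmdom' B"
      "\<And>l G P. fmlookup B l = Some G \<Longrightarrow> fmlookup C l = Some P \<Longrightarrow> proj G r P" "p \<noteq> r"
    for q r :: 'p and B :: "('l, ('p, 'l) gtype) fmap" and C M
  proof -
    have "reads n p (chan p r M) X" if X: "fmlookup C k = Some X" for k X
    proof -
      obtain H where H: "fmlookup B k = Some H"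
        using G(4) X by (rule fmdom'_eq_lookup)
      have "reads n p (chan p r (M \<cdot> qmsg r k q)) X"
      proof (rule Suc.IH)
        show "global_type H" using G(1) H by (rule global_type_GOutD)
        show "gbounded H" using G(2) H by (rule gbounded_GOutD)
        show "balanced H (M \<cdot> qmsg r k q)" using G(3) H by (rule balanced_GOutD(1))
        show "proj H r X" using H X by (rule G(5))
        show "p \<noteq> r" by (rule G(6))
      qed
      then show ?thesis using G(6) by (simp add: chan_qmsg)
    qed
    then show ?thesis by simp
  qed
  have receiver_case: "reads (Suc n) p (chan p r M) (Recv q (fmupd l P fmempty))"
    if G: "global_type (GIn q r l G)" "gbounded (GIn q r l G)" "balanced (GIn q r l G) M"
      "proj G r P" "p \<noteq> r" for q r l and G :: "('p, 'l) gtype" and P M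
  proof -
    obtain K where K: "M = qmsg q l r \<cdot> K" "balanced G K" using G(3) by (rule balanced_GInD)
    have "reads n p (chan p r K) P"
      using global_type_GInD[OF G(1)] gbounded_GInD[OF G(2)] K(2) G(4,5) by (rule Suc.IH)
    then show ?thesis using K(1) by (simp add: chan_qmsg reads_Recv_singleton del: reads.simps(2))
  qed
  have "depth_finite G r" using Suc.prems(1,2) by (rule gbounded_depth_finite)
  then show ?case
    using Suc.prems
  proof (induction G r arbitrary: M P rule: depth_finite.induct)
    case (depth_notin r G)
    have "P = Inact"
      using depth_notin.prems(1,3,4) depth_notin.hyps by (rule proj_notin_play)
    then show ?case by simp
  next
    case (depth_Out r q B)
    from depth_Out.prems(4) show ?case
    proof (cases rule: proj_GOutE)
      case (sender C)
      show ?thesis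
        unfolding sender(2) using depth_Out.prems(1-3) sender(3,4) depth_Out.prems(5)
        by (rule sender_case)
    qed (auto simp: play_GOut)
  next
    case (depth_In q r l G)
    from depth_In.prems(4) show ?case
    proof (cases rule: proj_GInE)
      case (receiver Q)
      show ?thesis
        unfolding receiver(2) using depth_In.prems(1-3) receiver(3) depth_In.prems(5)
        by (rule receiver_case)
    qed (auto)
  next
    case (depth_Out_child B r s q)
    have child: "reads (Suc n) p (chan p r (M \<cdot> qmsg s k q)) X"
      if H: "fmlookup B k = Some H" and X: "proj H r X" for k H X
      using H global_type_GOutD[OF depth_Out_child.prems(1) H] gbounded_GOutD[OF depth_Out_child.prems(2) H]
        balanced_GOutD(1)[OF depth_Out_child.prems(3) H] X depth_Out_child.prems(5)
      by (rule depth_Out_child.IH)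
    from depth_Out_child.prems(4) show ?case
    proof (cases rule: proj_GOutE)
      case (sender C)
      show ?thesis
        unfolding sender(2)
        using depth_Out_child.prems(1-3)[folded sender(1)] sender(3) sender(4)[folded sender(1)]
          depth_Out_child.prems(5)
        by (rule sender_case)
    next
      case (single l H)
      then have "reads (Suc n) p (chan p r (M \<cdot> qmsg s l q)) P" by (intro child) simp_all
      then show ?thesis unfolding chan_qappend by (rule reads_append)
    next
      case (choice C \<pi>)
      have child': "reads (Suc n) p (chan p r (M \<cdot> qmsg s k q)) (prefix_actions \<pi> (Recv s (fmupd k X fmempty)))"
        if X: "fmlookup C k = Some X" for k X
      proof -
        obtain H where H: "fmlookup B k = Some H" using choice(4) X by (rule fmdom'_eq_lookup)
        show ?thesis using H choice(6)[OF H X] choice(1) by (intro child) simp_all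
      qed
      have "card (fmdom' C) > 1" using choice(3,4) by simp
      then obtain a b x y where ab: "a \<noteq> b" "fmlookup C a = Some x" "fmlookup C b = Some y"
        by (rule card_fmdom'_gt_1)
      show ?thesis
      \<comment> \<open>For \<open>s = p\<close> each branch extends the forced word by its own
        label; otherwise all branches force the same word.\<close>
      proof (cases "s = p")
        case True
        have "reads (Suc n) p (chan p r M @ [k]) (prefix_actions \<pi> (Recv p (fmupd k X fmempty)))"
          if X: "fmlookup C k = Some X" for k X
          using child'[OF X] True choice(1) by (simp add: chan_qmsg del: reads.simps(2))
        then show ?thesis unfolding choice(5) True
          by (rule reads_prefix_actions_same[OF ab(2,3,1)])
      next
        case False
        have "reads (Suc n) p (chan p r M) (prefix_actions \<pi> (Recv s (fmupd k X fmempty)))"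
          if X: "fmlookup C k = Some X" for k X
          using child'[OF X] False by (simp add: chan_qmsg del: reads.simps(2))
        moreover have "C \<noteq> fmempty" using ab(2) by auto
        ultimately show ?thesis unfolding choice(5)
          using False by (intro reads_prefix_actions_other[where C = C])
      qed
    next
      case other
      obtain l H where H: "fmlookup B l = Some H"
        using depth_Out_child.prems(1) by (rule global_type_GOut_nonempty)
      have "reads (Suc n) p (chan p r (M \<cdot> qmsg s l q)) P" using H other(3)[OF H] by (rule child)
      then show ?thesis unfolding chan_qappend by (rule reads_append)
    qed simp
  next
    case (depth_In_child G r s q l)
    from depth_In_child.prems(4) show ?case
    proof (cases rule: proj_GInE)
      case (receiver Q)
      show ?thesis
        unfolding receiver(2)
        using depth_In_child.prems(1-3)[folded receiver(1)] receiver(3)[folded receiver(1)]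
          depth_In_child.prems(5)
        by (rule receiver_case)
    next
      case other
      obtain K where K: "M = qmsg s l q \<cdot> K" "balanced G K"
        using depth_In_child.prems(3) by (rule balanced_GInD)
      have "reads (Suc n) p (chan p r K) P"
        using global_type_GInD[OF depth_In_child.prems(1)] gbounded_GInD[OF depth_In_child.prems(2)]
          K(2) other(2) depth_In_child.prems(5) by (rule depth_In_child.IH)
      then show ?thesis using K(1) other(1) by (simp add: chan_qmsg del: reads.simps(2))
    qed simp
  qed
qed simp

section \<open>Session fidelity\<close>

primrec player_action :: "('p, 'l) comm \<Rightarrow> ('p, 'l) action" where
  "player_action (OutC p q l) = SendA q l"
| "player_action (InC p q l) = RecvA p l"

inductive proc_step :: "('p, 'l) action \<Rightarrow> ('p, 'l) proc \<Rightarrow> ('p, 'l) proc \<Rightarrow> bool" where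
  step_Send: "fmlookup C l = Some P \<Longrightarrow> proc_step (SendA q l) (Send q C) P"
| step_Recv: "fmlookup C l = Some P \<Longrightarrow> proc_step (RecvA q l) (Recv q C) P"

lemma proc_step_Send_iff: "proc_step a (Send q C) P \<longleftrightarrow> (\<exists>l. a = SendA q l \<and> fmlookup C l = Some P)"
  by (subst proc_step.simps) auto

lemma proc_step_Recv_iff: "proc_step a (Recv q C) P \<longleftrightarrow> (\<exists>l. a = RecvA q l \<and> fmlookup C l = Some P)"
  by (subst proc_step.simps) auto

lemma proc_step_unique: "proc_step a P Q \<Longrightarrow> proc_step a P R \<Longrightarrow> Q = R"
  by (auto elim!: proc_step.cases)

lemma proc_step_prefix_action_iff: "proc_step a (prefix_action b P) Q \<longleftrightarrow> a = b \<and> Q = P"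
  by (cases b) (auto simp: proc_step_Send_iff proc_step_Recv_iff split: if_splits)

lemma process_proc_step: "proc_step a P Q \<Longrightarrow> process P \<Longrightarrow> process Q"
  by (auto elim!: proc_step.cases dest: process_SendD process_RecvD)

lemma proc_le_step:
  assumes "P \<preceq> Q" and "proc_step a Q Q'"
  obtains P' where "proc_step a P P'" "P' \<preceq> Q'"
  using assms(2)
proof cases
  case (step_Send C l q)
  from assms(1)[unfolded step_Send] obtain B where B: "P = Send q B" "fmdom' B = fmdom' C"
    "\<And>l P Q. fmlookup B l = Some P \<Longrightarrow> fmlookup C l = Some Q \<Longrightarrow> P \<preceq> Q"
    by (rule proc_le_SendE) blast
  obtain P' where "fmlookup B l = Some P'"
    using B(2)[symmetric] step_Send(3) by (rule fmdom'_eq_lookup)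
  moreover from this have "P' \<preceq> Q'" using step_Send(3) by (rule B(3))
  ultimately show ?thesis using B(1) step_Send(1) by (intro that[of P']) (simp_all add: proc_step.step_Send)
next
  case (step_Recv C l q)
  from assms(1)[unfolded step_Recv] obtain B where B: "P = Recv q B" "fmdom' C \<subseteq> fmdom' B"
    "\<And>l P Q. fmlookup B l = Some P \<Longrightarrow> fmlookup C l = Some Q \<Longrightarrow> P \<preceq> Q"
    by (rule proc_le_RecvE) blast
  have "l \<in> fmdom' B" using B(2) step_Recv(3) by (auto intro: fmdom'I)
  then obtain P' where "fmlookup B l = Some P'" by (auto simp: fmlookup_dom'_iff)
  moreover from this have "P' \<preceq> Q'" using step_Recv(3) by (rule B(3))
  ultimately show ?thesis using B(1) step_Recv(1) by (intro that[of P']) (simp_all add: proc_step.step_Recv)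
qed

text \<open>The nodes crossed by \<open>IComm_Out\<close> and \<open>IComm_In\<close> are not played
  by \<open>r\<close>, so its action stays in front. The delicate case is an output to
  \<open>r\<close>, whose branches are merged behind a common prefix.\<close>

lemma type_step_player_projection:
  assumes "type_step (G, M) \<beta> (G', M')"
    and "global_type G" and "balanced G M" and "proj G r P" and "r \<in> play_comm \<beta>"
  shows "\<exists>P'. proc_step (player_action \<beta>) P P' \<and> proj G' r P'"
  using assms
proof (induction "(G, M)" \<beta> "(G', M')" arbitrary: G M G' M' P)
  case (Ext_Out B l G p q M)
  have "r = p" using Ext_Out.prems(4) by simp
  from Ext_Out.prems(3) show ?case
  proof (cases rule: proj_GOutE)
    case (sender C)
    obtain P' where "fmlookup C l = Some P'"
      using sender(3)[symmetric] Ext_Out.hyps by (rule fmdom'_eq_lookup)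
    then show ?thesis using sender Ext_Out.hyps by (auto intro: step_Send)
  qed (use \<open>r = p\<close> in \<open>simp_all add: play_GOut\<close>)
next
  case (Ext_In p q l G M)
  have "r = q" using Ext_In.prems(4) by simp
  from Ext_In.prems(3) show ?case
    by (cases rule: proj_GInE) (use \<open>r = q\<close> in \<open>simp_all add: proc_step_Recv_iff\<close>)
next
  case (IComm_Out B' B M p q \<beta> M')
  have step: "type_step (GOut p q B, M) \<beta> (GOut p q B', M')"
    using IComm_Out.hyps(1,2,4) by (rule type_step.IComm_Out)
  have "r \<in> play (GOut p q B)"
    using type_step_player[OF step IComm_Out.prems(1)] IComm_Out.prems(4) by blast
  have "r \<noteq> p" using IComm_Out.hyps(4) IComm_Out.prems(4) by auto
  have IH: "\<exists>P'. proc_step (player_action \<beta>) X P' \<and> proj H' r P'"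
    if H: "fmlookup B k = Some H" and H': "fmlookup B' k = Some H'" and X: "proj H r X" for k H H' X
    using H H' global_type_GOutD[OF IComm_Out.prems(1) H] balanced_GOutD(1)[OF IComm_Out.prems(2) H]
      X IComm_Out.prems(4)
    by (rule IComm_Out.hyps(3))
  from IComm_Out.prems(3) show ?case
  proof (cases rule: proj_GOutE)
    case (single k H)
    obtain H' where H': "B' = fmupd k H' fmempty" "fmlookup B' k = Some H'"
      using IComm_Out.hyps(1) unfolding single(3) by (rule fmdom'_eq_singleton)
    have "\<exists>P'. proc_step (player_action \<beta>) P P' \<and> proj H' r P'"
      using single H'(2) by (intro IH[of k H H' P]) simp_all
    then show ?thesis using single(1,2) H'(1) by (auto intro: proj_receiver_single)
  next
    case (choice C \<pi>)
    have child: "\<pi> = [] \<and> player_action \<beta> = RecvA p k \<or>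
        (\<exists>\<pi>'. \<pi> = player_action \<beta> # \<pi>' \<and> proj H' r (prefix_actions \<pi>' (Recv p (fmupd k X fmempty))))"
      if X: "fmlookup C k = Some X" and H': "fmlookup B' k = Some H'" for k X H'
    proof -
      obtain H where H: "fmlookup B k = Some H" using choice(4) X by (rule fmdom'_eq_lookup)
      obtain P' where P': "proc_step (player_action \<beta>) (prefix_actions \<pi> (Recv p (fmupd k X fmempty))) P'"
        "proj H' r P'"
        using IH[OF H H' choice(6)[OF H X, folded choice(1)]] by blast
      then show ?thesis
        by (cases \<pi>) (auto simp: proc_step_prefix_action_iff proc_step_Recv_iff split: if_splits)
    qed
    have dom: "fmdom' B' = fmdom' C" using choice(4) IComm_Out.hyps(1) by simp
    have "card (fmdom' C) > 1" using choice(3,4) by simp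
    then obtain a b X Y where ab: "a \<noteq> b" "fmlookup C a = Some X" "fmlookup C b = Some Y"
      by (rule card_fmdom'_gt_1)
    obtain H\<^sub>a where Ha: "fmlookup B' a = Some H\<^sub>a" using dom[symmetric] ab(2) by (rule fmdom'_eq_lookup)
    obtain H\<^sub>b where Hb: "fmlookup B' b = Some H\<^sub>b" using dom[symmetric] ab(3) by (rule fmdom'_eq_lookup)
    \<comment> \<open>Were the prefix empty, the action of \<open>\<beta>\<close> would have to be
      the input of both \<open>a\<close> and \<open>b\<close>. So it heads the prefix, and the tail
      is again common to all branches.\<close>
    obtain \<pi>' where \<pi>: "\<pi> = player_action \<beta> # \<pi>'"
      using child[OF ab(2) Ha] child[OF ab(3) Hb] ab(1) by auto
    have "proj (GOut p q B') q (prefix_actions \<pi>' (Recv p C))"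
    proof (rule proj_receiver_choice)
      show "proj H' q (prefix_actions \<pi>' (Recv p (fmupd k X fmempty)))"
        if "fmlookup B' k = Some H'" "fmlookup C k = Some X" for k H' X
        using child[OF that(2,1)] \<pi> choice(1) by simp
    qed (use choice IComm_Out.hyps(1) in simp_all)
    then show ?thesis using choice(1,5) \<pi> by (simp add: proc_step_prefix_action_iff)
  next
    case other
    obtain k H where H: "fmlookup B k = Some H"
      using IComm_Out.prems(1) by (rule global_type_GOut_nonempty)
    obtain H' where H': "fmlookup B' k = Some H'"
      using IComm_Out.hyps(1)[symmetric] H by (rule fmdom'_eq_lookup)
    obtain P' where P': "proc_step (player_action \<beta>) P P'"
      using IH[OF H H' other(3)[OF H]] by blast
    \<comment> \<open>Each branch yields a continuation of the same \<open>P\<close> by the same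
      action, so they coincide.\<close>
    have "proj K' r P'" if K': "fmlookup B' j = Some K'" for j K'
    proof -
      obtain K where K: "fmlookup B j = Some K"
        using IComm_Out.hyps(1) K' by (rule fmdom'_eq_lookup)
      show ?thesis using IH[OF K K' other(3)[OF K]] proc_step_unique[OF P'] by blast
    qed
    then have "proj (GOut p q B') r P'"
      using type_step_global_type[OF step IComm_Out.prems(1)]
        type_step_balanced[OF step IComm_Out.prems(2)] other(1,2)
      by (intro proj_other_OutI)
    then show ?thesis using P' by blast
  qed (use \<open>r \<noteq> p\<close> \<open>r \<in> play (GOut p q B)\<close> in simp_all)
next
  case (IComm_In G M \<beta> G' M' q p l)
  have step: "type_step (GIn p q l G, qmsg p l q \<cdot> M) \<beta> (GIn p q l G', qmsg p l q \<cdot> M')"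
    using IComm_In.hyps(1,3) by (rule type_step.IComm_In)
  have "r \<in> play (GIn p q l G)"
    using type_step_player[OF step IComm_In.prems(1)] IComm_In.prems(4) by blast
  have "r \<noteq> q" using IComm_In.hyps(3) IComm_In.prems(4) by auto
  from IComm_In.prems(3) show ?case
  proof (cases rule: proj_GInE)
    case other
    have "\<exists>P'. proc_step (player_action \<beta>) P P' \<and> proj G' r P'"
      using global_type_GInD[OF IComm_In.prems(1)] IComm_In.prems(2,4) other(2)
      by (intro IComm_In.hyps(2)) simp_all
    moreover have "proj (GIn p q l G') r P'" if "proj G' r P'" for P'
      using type_step_global_type[OF step IComm_In.prems(1)]
        type_step_balanced[OF step IComm_In.prems(2)] other(1) that
      by (rule proj_other_InI)
    ultimately show ?thesis by blast
  qed (use \<open>r \<noteq> q\<close> \<open>r \<in> play (GIn p q l G)\<close> in simp_all)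
qed

section \<open>Projections onto participants that do not play\<close>

lemma next_state_None [simp]: "next_state p q None = None"
  by (simp add: next_state_def)

lemma advance_None [simp]: "advance p \<pi> None = None"
  by (induction \<pi>) (simp_all split: action.split)

lemma narrow_prefix_actions_Recv:
  assumes "q \<noteq> p \<or> s = None"
  shows "narrow p l s (prefix_actions \<pi> (Recv q C)) =
    prefix_actions \<pi> (Recv q (fmmap (narrow p l (advance p \<pi> s)) C))"
  using assms by (auto simp: narrow_prefix_actions pick_def next_state_def)

primrec comm_sender :: "('p, 'l) comm \<Rightarrow> 'p" where
  "comm_sender (OutC p q l) = p"
| "comm_sender (InC p q l) = p"

primrec comm_label :: "('p, 'l) comm \<Rightarrow> 'l" where
  "comm_label (OutC p q l) = l"
| "comm_label (InC p q l) = l"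

text \<open>The messages already on the channel are read first, so the new one is consumed by the
  input of index \<open>length (chan p q M)\<close>, counted from 0. An input communication resolves
  no choice and calls for no cut.\<close>

primrec receiver_state :: "('p, 'l) comm \<Rightarrow> ('p, 'l) queue \<Rightarrow> 'p \<Rightarrow> nat option" where
  "receiver_state (OutC p q l) M r = (if r = q then Some (length (chan p q M)) else None)"
| "receiver_state (InC p q l) M r = None"

text \<open>For participants other than the receiver the state \<open>None\<close> makes \<open>narrow\<close> the identity.\<close>

definition residual :: "('p, 'l) comm \<Rightarrow> ('p, 'l) queue \<Rightarrow> 'p \<Rightarrow> ('p, 'l) proc \<Rightarrow> ('p, 'l) proc" where
  "residual \<beta> M r P = narrow (comm_sender \<beta>) (comm_label \<beta>) (receiver_state \<beta> M r) P"

lemma residual_Inact [simp]: "residual \<beta> M r Inact = Inact"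
  by (simp add: residual_def)

lemma residual_Send [simp]: "residual \<beta> M r (Send q C) = Send q (fmmap (residual \<beta> M r) C)"
proof -
  have "residual \<beta> M r = narrow (comm_sender \<beta>) (comm_label \<beta>) (receiver_state \<beta> M r)"
    by (rule ext) (rule residual_def)
  then show ?thesis by simp
qed

lemma residual_OutC_self: "residual (OutC p q l) M q P = narrow p l (Some (length (chan p q M))) P"
  by (simp add: residual_def)

lemma residual_id: "(\<And>p l. \<beta> \<noteq> OutC p r l) \<Longrightarrow> residual \<beta> M r P = P"
  by (cases \<beta>) (auto simp: residual_def intro: narrow_id)

text \<open>Inside a branch the queue holds one more message, sent by \<open>p\<close>. If
  \<open>\<beta>\<close> is an output, its sender is not \<open>p\<close>, so that message lies on
  another channel and the counter is the same in all branches.\<close>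

lemma residual_qmsg_right:
  assumes "p \<notin> play_comm \<beta>"
  shows "residual \<beta> (M \<cdot> qmsg p l q) r P = residual \<beta> M r P"
  using assms by (cases \<beta>) (auto simp: residual_def chan_qmsg)

text \<open>The choice made by \<open>p\<close> is not the one resolved by \<open>\<beta>\<close>,
  so nothing is cut there. As \<open>f\<close> does not depend on \<open>C\<close>, the whole
  branching and its singletons are transformed alike, as \<open>proj_receiver_choice\<close>
  requires.\<close>

lemma residual_prefix_actions:
  assumes "p \<notin> play_comm \<beta>"
  obtains f where "\<And>C. residual \<beta> M r (prefix_actions \<pi> (Recv p C)) = prefix_actions \<pi> (Recv p (fmmap f C))"
proof -
  have "p \<noteq> comm_sender \<beta> \<or> receiver_state \<beta> M r = None" using assms by (cases \<beta>) auto
  then show ?thesis using narrow_prefix_actions_Recv that unfolding residual_def by metis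
qed

text \<open>When \<open>\<beta>\<close> is an output to \<open>q\<close>, removing the front message
  shortens its channel exactly when \<open>next_state\<close> lowers the counter.\<close>

lemma residual_Recv_singleton:
  assumes "q \<notin> play_comm \<beta>"
  shows "residual \<beta> (qmsg p l q \<cdot> M) q (Recv p (fmupd l P fmempty)) = Recv p (fmupd l (residual \<beta> M q P) fmempty)"
  using assms by (cases \<beta>) (auto simp: residual_def chan_qmsg next_state_def)

lemma residual_qmsg_left: "q \<noteq> r \<Longrightarrow> residual \<beta> (qmsg p l q \<cdot> M) r P = residual \<beta> M r P"
  by (cases \<beta>) (auto simp: residual_def chan_qmsg)

lemma type_step_residual_projection:
  assumes "type_step (G, M) \<beta> (G', M')"
    and "global_type G" and "gbounded G" and "balanced G M"
    and "proj G r P" and "r \<notin> play_comm \<beta>"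
  shows "proj G' r (residual \<beta> M r P)"
  using assms
proof (induction "(G, M)" \<beta> "(G', M')" arbitrary: G M G' M' P)
  case (Ext_Out B l G p q M)
  \<comment> \<open>In branch \<open>k\<close> the channel to \<open>q\<close> is prolonged by
    \<open>k\<close>, so the projection reads the queued labels and then \<open>k\<close>.\<close>
  have reads: "reads n p (chan p r M @ [k]) Q"
    if k: "fmlookup B k = Some H" and Q: "proj H q Q" and "r = q" for n k H Q
  proof -
    have "reads n p (chan p r (M \<cdot> qmsg p k q)) Q"
    proof (rule proj_reads)
      show "global_type H" using Ext_Out.prems(1) k by (rule global_type_GOutD)
      show "gbounded H" using Ext_Out.prems(2) k by (rule gbounded_GOutD)
      show "balanced H (M \<cdot> qmsg p k q)" using Ext_Out.prems(3) k by (rule balanced_GOutD(1))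
      show "proj H r Q" using Q \<open>r = q\<close> by simp
      show "p \<noteq> r" using Ext_Out.prems(5) by auto
    qed
    then show ?thesis using \<open>r = q\<close> by (simp add: chan_qmsg)
  qed
  from Ext_Out.prems(4) show ?case
  proof (cases rule: proj_GOutE)
    case notin
    then have "r \<notin> play G" using Ext_Out.hyps by (auto simp: play_GOut)
    then show ?thesis using notin(2) by (simp add: proj_Inact)
  next
    case sender
    then show ?thesis using Ext_Out.prems(5) by simp
  next
    case (single k H)
    then have "k = l" "H = G" using Ext_Out.hyps by (auto split: if_splits)
    \<comment> \<open>With a single branch, \<open>l\<close> is already forced at the place of the
      cut.\<close>
    then have "residual (OutC p q l) M q P = P"
      unfolding residual_OutC_self using reads[OF Ext_Out.hyps] single by (intro narrow_id) auto
    then show ?thesis using single \<open>H = G\<close> by simp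
  next
    case (choice C \<pi>)
    have "card (fmdom' C) > 1" using choice(3,4) by simp
    then obtain a b X Y where ab: "a \<noteq> b" "fmlookup C a = Some X" "fmlookup C b = Some Y"
      by (rule card_fmdom'_gt_1)
    obtain Q where Q: "fmlookup C l = Some Q"
      using choice(4)[symmetric] Ext_Out.hyps by (rule fmdom'_eq_lookup)
    have "reads n p (chan p q M @ [k]) (prefix_actions \<pi> (Recv p (fmupd k Z fmempty)))"
      if Z: "fmlookup C k = Some Z" for n k Z
    proof -
      obtain H where H: "fmlookup B k = Some H" using choice(4) Z by (rule fmdom'_eq_lookup)
      show ?thesis using reads[OF H choice(6)[OF H Z] choice(1)] choice(1) by simp
    qed
    \<comment> \<open>The cut yields the very singleton that the clause for choices prescribes as
      the projection of branch \<open>l\<close>, which is \<open>G\<close>.\<close>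
    then have "residual (OutC p q l) M q P = prefix_actions \<pi> (Recv p (fmupd l Q fmempty))"
      unfolding residual_OutC_self choice(5)
      by (rule narrow_prefix_actions_choice[OF ab(2,3,1) _ Q])
    then show ?thesis using choice(1) choice(6)[OF Ext_Out.hyps Q] by simp
  next
    case other
    then show ?thesis using Ext_Out.hyps by (auto simp: residual_id)
  qed
next
  case (Ext_In p q l G M)
  from Ext_In.prems(4) show ?case
  proof (cases rule: proj_GInE)
    case notin
    then show ?thesis by (simp add: proj_Inact)
  next
    case receiver
    then show ?thesis using Ext_In.prems(5) by simp
  next
    case other
    then show ?thesis by (simp add: residual_id)
  qed
next
  case (IComm_Out B' B M p q \<beta> M')
  have step: "type_step (GOut p q B, M) \<beta> (GOut p q B', M')"
    using IComm_Out.hyps(1,2,4) by (rule type_step.IComm_Out)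
  have dom: "fmdom' B = fmdom' B'" using IComm_Out.hyps(1) by simp
  have IH: "proj H' r (residual \<beta> M r X)"
    if H: "fmlookup B k = Some H" and H': "fmlookup B' k = Some H'" and X: "proj H r X" for k H H' X
  proof -
    have "proj H' r (residual \<beta> (M \<cdot> qmsg p k q) r X)"
      using H H' global_type_GOutD[OF IComm_Out.prems(1) H] gbounded_GOutD[OF IComm_Out.prems(2) H]
        balanced_GOutD(1)[OF IComm_Out.prems(3) H] X IComm_Out.prems(5)
      by (rule IComm_Out.hyps(3))
    then show ?thesis using IComm_Out.hyps(4) by (simp add: residual_qmsg_right)
  qed
  from IComm_Out.prems(4) show ?case
  proof (cases rule: proj_GOutE)
    case notin
    then show ?thesis using type_step_play[OF step] by (auto intro: proj_Inact)
  next
    case (sender C)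
    have "proj (GOut p q B') p (Send q (fmmap (residual \<beta> M p) C))"
    proof (rule proj_sender)
      show "fmdom' (fmmap (residual \<beta> M p) C) = fmdom' B'" using sender(3) dom by simp
      fix k H' Y
      assume H': "fmlookup B' k = Some H'" and "fmlookup (fmmap (residual \<beta> M p) C) k = Some Y"
      then obtain X where X: "fmlookup C k = Some X" "Y = residual \<beta> M p X" by auto
      obtain H where H: "fmlookup B k = Some H" using IComm_Out.hyps(1) H' by (rule fmdom'_eq_lookup)
      show "proj H' p Y" using IH[OF H H'] sender(4)[OF H X(1)] sender(1) X(2) by simp
    qed
    then show ?thesis by (simp add: sender(1,2))
  next
    case (single k H)
    obtain H' where H': "B' = fmupd k H' fmempty" "fmlookup B' k = Some H'"
      using IComm_Out.hyps(1) unfolding single(3) by (rule fmdom'_eq_singleton)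
    have "proj H' r (residual \<beta> M r P)"
      using single H'(2) by (intro IH[of k H H' P]) simp_all
    then show ?thesis using single(1,2) H'(1) by (auto intro: proj_receiver_single)
  next
    case (choice C \<pi>)
    obtain f where f: "\<And>C. residual \<beta> M r (prefix_actions \<pi> (Recv p C)) = prefix_actions \<pi> (Recv p (fmmap f C))"
      using residual_prefix_actions[OF IComm_Out.hyps(4)] by blast
    have "proj (GOut p q B') q (prefix_actions \<pi> (Recv p (fmmap f C)))"
    proof (rule proj_receiver_choice)
      fix k H' Y
      assume H': "fmlookup B' k = Some H'" and "fmlookup (fmmap f C) k = Some Y"
      then obtain X where X: "fmlookup C k = Some X" "Y = f X" by auto
      obtain H where H: "fmlookup B k = Some H" using IComm_Out.hyps(1) H' by (rule fmdom'_eq_lookup)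
      show "proj H' q (prefix_actions \<pi> (Recv p (fmupd k Y fmempty)))"
        using IH[OF H H' choice(6)[OF H X(1), folded choice(1)], unfolded f] choice(1) X(2) by simp
    qed (use choice dom in simp_all)
    then show ?thesis by (simp add: choice(1,5) f[unfolded choice(1)])
  next
    case other
    show ?thesis
    proof (rule proj_other_OutI)
      show "global_type (GOut p q B')" using step IComm_Out.prems(1) by (rule type_step_global_type)
      show "balanced (GOut p q B') M'" using step IComm_Out.prems(3) by (rule type_step_balanced)
      fix k H'
      assume H': "fmlookup B' k = Some H'"
      obtain H where H: "fmlookup B k = Some H" using IComm_Out.hyps(1) H' by (rule fmdom'_eq_lookup)
      show "proj H' r (residual \<beta> M r P)" using H H' other(3)[OF H] by (rule IH)
    qed (rule other(1,2))+
  qed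
next
  case (IComm_In G M \<beta> G' M' q p l)
  have step: "type_step (GIn p q l G, qmsg p l q \<cdot> M) \<beta> (GIn p q l G', qmsg p l q \<cdot> M')"
    using IComm_In.hyps(1,3) by (rule type_step.IComm_In)
  have IH: "proj G' r (residual \<beta> M r X)" if X: "proj G r X" for X
    using global_type_GInD[OF IComm_In.prems(1)] gbounded_GInD[OF IComm_In.prems(2)]
      IComm_In.prems(3,5) X
    by (intro IComm_In.hyps(2)) simp_all
  from IComm_In.prems(4) show ?case
  proof (cases rule: proj_GInE)
    case notin
    then have "r \<notin> play (GIn p q l G')" using type_step_play[OF step] by blast
    then show ?thesis by (simp add: notin(2) proj_Inact)
  next
    case (receiver Q)
    have "proj (GIn p q l G') q (Recv p (fmupd l (residual \<beta> M q Q) fmempty))"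
      using IH receiver(1,3) by (intro proj_In) simp
    then show ?thesis
      using receiver(1,2) residual_Recv_singleton[OF IComm_In.hyps(3)] by simp
  next
    case other
    have "proj (GIn p q l G') r (residual \<beta> M r P)"
      using type_step_global_type[OF step IComm_In.prems(1)]
        type_step_balanced[OF step IComm_In.prems(3)] other(1) IH[OF other(2)]
      by (rule proj_other_InI)
    then show ?thesis using other(1) by (simp add: residual_qmsg_left)
  qed
qed

section \<open>From projections to typed networks\<close>

lemma type_step_projection:
  assumes "type_step (G, M) \<beta> (G', M')" and "well_formed G M"
    and "projection G r P" and "r \<notin> play_comm \<beta>"
  shows "\<exists>P'. projection G' r P' \<and> P \<preceq> P'"
proof -
  have "proj G' r (residual \<beta> M r P)"
    using assms by (intro type_step_residual_projection) (auto simp: well_formed_def projection_def)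
  moreover have "process (residual \<beta> M r P)" "P \<preceq> residual \<beta> M r P"
    using assms(3) by (simp_all add: residual_def projection_def process_narrow proc_le_narrow)
  ultimately show ?thesis unfolding projection_def by blast
qed

lemma type_step_projection_player:
  assumes "type_step (G, M) \<beta> (G', M')" and "well_formed G M"
    and "projection G r P" and "r \<in> play_comm \<beta>"
  shows "\<exists>P'. projection G' r P' \<and> proc_step (player_action \<beta>) P P'"
proof -
  obtain P' where P': "proc_step (player_action \<beta>) P P'" "proj G' r P'"
    using type_step_player_projection[OF assms(1) _ _ _ assms(4), of P] assms(2,3)
    by (auto simp: well_formed_def projection_def)
  then have "process P'" using assms(3) process_proc_step[OF P'(1)] by (simp add: projection_def)
  with P' show ?thesis by (auto simp: projection_def)
qed

text \<open>Projections exist after the step because the narrowed process serves for idle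
  participants and the continuation for the player.\<close>

lemma type_step_well_formed:
  assumes "type_step (G, M) \<beta> (G', M')" and "well_formed G M"
  shows "well_formed G' M'"
  unfolding well_formed_def
proof (intro conjI allI)
  have wf: "global_type G" "balanced G M" "gbounded G" "\<And>r. \<exists>P. projection G r P"
    using assms(2) by (auto simp: well_formed_def)
  show "global_type G'" using assms(1) wf(1) by (rule type_step_global_type)
  show "balanced G' M'" using assms(1) wf(2) by (rule type_step_balanced)
  show "gbounded G'" using assms(1) wf(1,3) by (rule type_step_gbounded)
  show "\<exists>P. projection G' r P" for r
  proof -
    obtain P where P: "projection G r P" using wf(4) by blast
    show ?thesis
      using type_step_projection[OF assms P] type_step_projection_player[OF assms P] by blast
  qed
qed

text \<open>The network rules act at the ends of the queue, whereas a type step may act below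
  pending nodes; modulo swaps both produce the same queue.\<close>

lemma net_step_player:
  assumes "type_step (G, M) \<beta> (G', M')" and "global_type G"
    and "r \<in> play_comm \<beta>" and "proc_step (player_action \<beta>) (N r) P"
  shows "net_step (N, M) \<beta> (N(r := P), M')"
proof (cases \<beta>)
  case (OutC p q l)
  then obtain B where "N r = Send q B" "fmlookup B l = Some P"
    using assms(4) by (auto elim: proc_step.cases)
  then show ?thesis
    using assms(1-3) OutC type_step_output_queue[of G M p q l G' M'] net_Out[of N p q B l P M] by simp
next
  case (InC p q l)
  then obtain B where "N r = Recv p B" "fmlookup B l = Some P"
    using assms(4) by (auto elim: proc_step.cases)
  then show ?thesis
    using assms(1-3) InC type_step_input_queue[of G M p q l G' M'] net_In[of N q p B l P M'] by simp
qed

theorem theorem3p18: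
  fixes N :: "('p, 'l) net"
    and G G' :: "('p, 'l) gtype"
    and M M' :: "('p, 'l) queue"
    and \<beta> :: "('p, 'l) comm"
  assumes "network N"
    and "well_formed G M"
    and "typing N G M"
    and "type_step (G, M) \<beta> (G', M')"
  shows "\<exists>N'. network N' \<and> net_step (N, M) \<beta> (N', M') \<and> typing N' G' M'"
proof -
  obtain A P where A: "finite A" "N = parallel A P" "play G \<subseteq> A"
    and P: "\<And>p. p \<in> A \<Longrightarrow> \<exists>Q. projection G p Q \<and> P p \<preceq> Q"
    using assms(3) unfolding typing_def by blast
  have gt: "global_type G" using assms(2) by (simp add: well_formed_def)
  obtain r where r: "play_comm \<beta> = {r}" by (cases \<beta>) auto
  \<comment> \<open>The player occurs in \<open>G\<close>, so its process is one of those governed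
    by a projection.\<close>
  then have "r \<in> A" using type_step_player[OF assms(4) gt] A(3) by auto
  then have "N r = P r" using A(2) by (simp add: parallel_def)
  obtain Q where Q: "projection G r Q" "P r \<preceq> Q" using P \<open>r \<in> A\<close> by blast
  then obtain Q' where Q': "projection G' r Q'" "proc_step (player_action \<beta>) Q Q'"
    using type_step_projection_player[OF assms(4,2)] r by blast
  obtain P' where P': "proc_step (player_action \<beta>) (P r) P'" "P' \<preceq> Q'"
    using Q(2) Q'(2) by (rule proc_le_step)
  let ?N' = "N(r := P')"
  have "network ?N'"
  proof -
    have "{p. ?N' p \<noteq> Inact} \<subseteq> insert r {p. N p \<noteq> Inact}" by auto
    then have "finite {p. ?N' p \<noteq> Inact}"
      using assms(1) finite_subset unfolding network_def by blast
    moreover have "process P'"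
      using P'(1) assms(1) \<open>N r = P r\<close> process_proc_step unfolding network_def by metis
    ultimately show ?thesis using assms(1) by (simp add: network_def)
  qed
  moreover have "net_step (N, M) \<beta> (?N', M')"
    using assms(4) gt P'(1) r \<open>N r = P r\<close> by (intro net_step_player) simp_all
  moreover have "typing ?N' G' M'"
    unfolding typing_def
  proof (intro conjI exI)
    show "well_formed G' M'" using assms(4,2) by (rule type_step_well_formed)
    show "finite A" by (rule A(1))
    show "?N' = parallel A (P(r := P'))" using A(2) \<open>r \<in> A\<close> by (auto simp: parallel_def)
    show "play G' \<subseteq> A" using type_step_play[OF assms(4)] A(3) by blast
    show "\<forall>p\<in>A. \<exists>Q. projection G' p Q \<and> (P(r := P')) p \<preceq> Q"
    proof
      fix p
      assume "p \<in> A"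
      show "\<exists>Q. projection G' p Q \<and> (P(r := P')) p \<preceq> Q"
      proof (cases "p = r")
        case True
        then show ?thesis using Q'(1) P'(2) by auto
      next
        case False
        obtain R where R: "projection G p R" "P p \<preceq> R" using P \<open>p \<in> A\<close> by blast
        then obtain R' where "projection G' p R'" "R \<preceq> R'"
          using type_step_projection[OF assms(4,2) R(1)] False r by auto
        then show ?thesis using R(2) False proc_le_trans by auto
      qed
    qed
  qed
  ultimately show ?thesis by blast
qed

end
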